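(* Let $0<\alpha<1$ and let $\lambda$ be a nonnegative Borel measure on $S^1$ which is $\alpha$-dimensional in the sense that there is a constant $C_\lambda$ with $\lambda(B(\omega,\delta))\le C_\lambda\,\delta^\alpha$ for all $\omega\in S^1$ and all $\delta>0$. Suppose $p,q,s\in[1,\infty]$ satisfy the three strict inequalities $$\frac{2}{p}<1+\frac{1}{s},\qquad \frac{1}{p}<\frac{1}{s}+\frac{\alpha}{q},\qquad \frac{1-\alpha}{p}<\frac{1}{s}.$$ Then there is a constant $C<\infty$ (independent of $f$) such that for all Borel functions $f\in L^p(\mathbb{R}^2)$ $$\Big[\int_{S^1}\Big(\int_{-1}^1 |Rf(t,\omega)|^s\,dt\Big)^{q/s}d\lambda(\omega)\Big]^{1/q}\le C\,\|f\|_{L^p(\mathbb{R}^2)},$$ where $Rf$ is the Radon transform $Rf(t,\omega)=\int_{-1}^1 f(t\,\omega+s'\,\omega^\perp)\,ds'$.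
   Context: $S^1$ is the unit circle in $\mathbb{R}^2$, and $B(\omega,\delta)$ is the ball of center $\omega$ and radius $\delta$ in $S^1$. For each $\omega\in S^1$, $\omega^\perp\in S^1$ denotes a fixed unit vector perpendicular to $\omega$ (the value of $Rf$ does not depend on which of the two is chosen). For $f$ on $\mathbb{R}^2$, $Rf(t,\omega)=\int_{-1}^1 f(t\omega+s'\omega^\perp)\,ds'$; for $f\in L^p(\mathbb{R}^2)$ with $p\ge 1$ and each $\omega$ this is defined for almost every $t\in[-1,1]$. The usual conventions apply: $1/\infty=0$, and if $q=\infty$ (or $s=\infty$) the corresponding norm is the essential supremum with respect to $\lambda$ (or Lebesgue measure on $[-1,1]$). *)

theory Defs
  imports "HOL-Probability.Essential_Supremum"
begin

text \<open>The power of an extended nonnegative number; only used for exponents \<open>a > 0\<close>,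
  whence \<open>\<infinity>\<close> is sent to \<open>\<infinity>\<close>.\<close>

definition ennreal_powr :: "ennreal \<Rightarrow> real \<Rightarrow> ennreal" where
  "ennreal_powr x a = (if x = \<infinity> then \<infinity> else ennreal (enn2real x powr a))"

text \<open>The norm is defined for \<open>[0,\<infinity>]\<close>-valued functions, so that mixed norms are
  obtained by nesting. It is meant for \<open>1 \<le> p \<le> \<infinity>\<close>.\<close>

definition Lp_norm :: "ennreal \<Rightarrow> 'a measure \<Rightarrow> ('a \<Rightarrow> ennreal) \<Rightarrow> ennreal" where
  "Lp_norm p M g =
     (if p = \<infinity> then esssup M g
      else ennreal_powr (\<integral>\<^sup>+ x. ennreal_powr (g x) (enn2real p) \<partial>M) (1 / enn2real p))"

abbreviation unit_circle :: "(real^2) set" where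
  "unit_circle \<equiv> sphere 0 1"

text \<open>Balls in the circle are taken with respect to the Euclidean distance; using arc length
  instead would only change the constant.\<close>

definition alpha_dimensional :: "real \<Rightarrow> (real^2) measure \<Rightarrow> bool" where
  "alpha_dimensional \<alpha> \<mu> \<longleftrightarrow>
     (\<exists>C::real. \<forall>\<omega>\<in>unit_circle. \<forall>\<delta>>0.
        emeasure \<mu> (ball \<omega> \<delta> \<inter> unit_circle) \<le> ennreal (C * \<delta> powr \<alpha>))"

text \<open>The argument \<open>perp\<close> is the choice of a unit vector perpendicular to each \<open>\<omega>\<close>.
  The Bochner integral is \<open>0\<close> where the integrand is not integrable; for \<open>f\<close> in \<open>L\<^sup>p\<close> and
  fixed \<open>\<omega>\<close> this concerns only a null set of \<open>t\<close> in \<open>[-1,1]\<close>.\<close>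

definition radon ::
  "(real^2 \<Rightarrow> real^2) \<Rightarrow> (real^2 \<Rightarrow> complex) \<Rightarrow> real \<Rightarrow> real^2 \<Rightarrow> complex" where
  "radon perp f t \<omega> = (LINT u:{-1..1}|lborel. f (t *\<^sub>R \<omega> + u *\<^sub>R perp \<omega>))"

end

theory Submission
  imports Defs
begin

text \<open>After normalising \<open>f\<close> in \<open>L\<^sup>p\<close>, split it along the sets
  \<open>E\<^sub>k = {2\<^sup>k < \<bar>f\<bar> \<le> 2\<^sup>k\<^sup>+\<^sup>1}\<close>, whose measures are at most \<open>2\<^sup>-\<^sup>k\<^sup>p\<close>, and let \<open>a(\<omega>)\<close> be the
  length of the set of those \<open>t\<close> for which \<open>R1\<^sub>E(t,\<omega>) \<approx> \<rho>\<close>, where \<open>E = E\<^sub>k\<close>. Besides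
  \<open>\<rho> a \<le> \<bar>E\<bar>\<close>, the decisive estimate is \<open>\<integral> a\<^sup>1\<^sup>-\<^sup>\<alpha> d\<lambda> \<le> K \<bar>E\<bar> \<rho>\<^sup>-\<^sup>1\<^sup>-\<^sup>\<alpha>\<close>. Its proof applies
  Cauchy--Schwarz on \<open>E\<close> to the superposition, with weights \<open>a(\<omega>)\<^sup>-\<^sup>\<alpha>\<close>, of the parts of \<open>E\<close> carried
  by these lines: for directions \<open>\<omega>, \<omega>'\<close> two such parts meet in measure at most
  \<open>min (2\<rho> a(\<omega>')) (a(\<omega>) a(\<omega>') / \<bar>sin \<angle>(\<omega>,\<omega>')\<bar>)\<close>, and as \<open>\<alpha> < 1\<close> the dimension condition
  bounds the integral of \<open>min (2\<rho>) (a(\<omega>) / \<bar>sin \<angle>(\<omega>,\<cdot>)\<bar>)\<close> by \<open>K' \<rho>\<^sup>1\<^sup>-\<^sup>\<alpha> a(\<omega>)\<^sup>\<alpha>\<close>.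
  Under the three strict inequalities the resulting bounds decay geometrically both in
  \<open>k\<close> and in \<open>log (1 / \<rho>)\<close>, so they can be summed by Minkowski's inequality.\<close>

section \<open>Powers and norms with values in \<open>[0,\<infinity>]\<close>\<close>

lemma ennreal_powr_top [simp]: "ennreal_powr \<infinity> a = \<infinity>" "ennreal_powr top a = top"
  by (simp_all add: ennreal_powr_def)

lemma ennreal_powr_ennreal [simp]: "0 \<le> x \<Longrightarrow> ennreal_powr (ennreal x) a = ennreal (x powr a)"
  by (simp add: ennreal_powr_def)

lemma ennreal_powr_zero [simp]: "ennreal_powr 0 a = 0"
  by (simp add: ennreal_powr_def)

lemma ennreal_powr_one [simp]: "ennreal_powr x 1 = x"
  by (cases x) auto

lemma borel_measurable_ennreal_powr [measurable (raw)]: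
  assumes [measurable]: "f \<in> borel_measurable M"
  shows "(\<lambda>x. ennreal_powr (f x) a) \<in> borel_measurable M"
  unfolding ennreal_powr_def by simp

lemma ennreal_powr_mono: "x \<le> y \<Longrightarrow> 0 \<le> a \<Longrightarrow> ennreal_powr x a \<le> ennreal_powr y a"
  by (cases x; cases y) (auto simp: powr_mono2 top_unique)

lemma ennreal_powr_mult:
  "0 < a \<Longrightarrow> ennreal_powr (x * y) a = ennreal_powr x a * ennreal_powr y a"
proof (cases "x = 0 \<or> y = 0")
  case False
  then show "0 < a \<Longrightarrow> ?thesis"
    by (cases x; cases y) (auto simp: ennreal_mult_top ennreal_top_mult powr_mult
        simp flip: ennreal_mult)
qed auto

lemma ennreal_powr_powr: "ennreal_powr (ennreal_powr x a) b = ennreal_powr x (a * b)"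
  by (cases x) (auto simp: powr_powr)

text \<open>For \<open>0 < a\<close> the powers \<open>a\<close> and \<open>1 / a\<close> are
  mutually inverse increasing maps of [0,\<infinity>], hence adjoint to each other. Adjointness is
  also why they commute with suprema.\<close>

lemma ennreal_powr_le_iff:
  assumes "0 < a"
  shows "ennreal_powr x a \<le> y \<longleftrightarrow> x \<le> ennreal_powr y (1 / a)"
proof
  assume "ennreal_powr x a \<le> y"
  from ennreal_powr_mono[OF this, of "1 / a"] assms show "x \<le> ennreal_powr y (1 / a)"
    by (simp add: ennreal_powr_powr)
next
  assume "x \<le> ennreal_powr y (1 / a)"
  from ennreal_powr_mono[OF this, of a] assms show "ennreal_powr x a \<le> y"
    by (simp add: ennreal_powr_powr)
qed

lemma ennreal_powr_SUP:
  assumes "0 < a" "I \<noteq> {}"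
  shows "ennreal_powr (SUP i\<in>I. f i) a = (SUP i\<in>I. ennreal_powr (f i) a)"
proof (rule antisym)
  show "ennreal_powr (SUP i\<in>I. f i) a \<le> (SUP i\<in>I. ennreal_powr (f i) a)"
    unfolding ennreal_powr_le_iff[OF assms(1)]
  proof (rule SUP_least)
    fix i assume "i \<in> I"
    then have "ennreal_powr (f i) a \<le> (SUP i\<in>I. ennreal_powr (f i) a)" by (rule SUP_upper)
    then show "f i \<le> ennreal_powr (SUP i\<in>I. ennreal_powr (f i) a) (1 / a)"
      by (simp add: ennreal_powr_le_iff[OF assms(1)])
  qed
  show "(SUP i\<in>I. ennreal_powr (f i) a) \<le> ennreal_powr (SUP i\<in>I. f i) a"
    by (intro SUP_least ennreal_powr_mono SUP_upper) (use assms in auto)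
qed

text \<open>Convexity of the p-th power, applied to a + b = t (a/t) + (1-t) (b/(1-t)). The weight
  \<open>t\<close> stays free: Minkowski's inequality comes from adapting it to the two
  norms.\<close>

lemma powr_add_le_weighted:
  fixes a b t p :: real
  assumes "0 \<le> a" "0 \<le> b" "0 < t" "t < 1" "1 \<le> p"
  shows "(a + b) powr p \<le> t powr (1 - p) * a powr p + (1 - t) powr (1 - p) * b powr p"
proof (cases "a = 0 \<or> b = 0")
  \<comment> \<open>Convexity is used on the open half-line only. If a summand vanishes, it suffices
    that \<open>t powr (1 - p)\<close> and \<open>(1 - t) powr (1 - p)\<close> are at least
    1.\<close>
  case True
  have "1 * c powr p \<le> u powr (1 - p) * c powr p" if "0 < u" "u < 1" for u c :: real
  proof (rule mult_right_mono)
    have "1 powr (1 - p) \<le> u powr (1 - p)"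
      by (rule powr_mono2') (use that assms in auto)
    then show "1 \<le> u powr (1 - p)" by simp
  qed auto
  from this[of t a] this[of "1 - t" b] True assms show ?thesis by auto
next
  case False
  have scale: "u * (c / u) powr p = u powr (1 - p) * c powr p" if "0 < u" "0 < c" for u c :: real
    using that by (simp add: powr_divide powr_diff field_simps)
  have "convex_on {0<..} (\<lambda>x. x powr p)" using assms by (intro powr_convex)
  from convex_onD[OF this, of "1 - t" "a / t" "b / (1 - t)"] False assms
  have "(t * (a / t) + (1 - t) * (b / (1 - t))) powr p
     \<le> t * (a / t) powr p + (1 - t) * (b / (1 - t)) powr p"
    by simp
  with False assms show ?thesis by (simp add: scale)
qed

lemma ennreal_powr_add_le_weighted:
  assumes "0 < t" "t < 1" "1 \<le> p"
  shows "ennreal_powr (x + y) p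
    \<le> ennreal (t powr (1 - p)) * ennreal_powr x p + ennreal ((1 - t) powr (1 - p)) * ennreal_powr y p"
proof (cases "x = top \<or> y = top")
  case True
  with assms show ?thesis by (auto simp: ennreal_mult_top)
next
  case False
  with assms powr_add_le_weighted[of "enn2real x" "enn2real y" t p] show ?thesis
    by (cases x; cases y) (auto simp flip: ennreal_plus ennreal_mult)
qed

section \<open>\<open>Lp_norm\<close> for finite exponents: Minkowski's inequality and comparison of
  exponents\<close>

lemma Lp_norm_ennreal:
  "0 < r \<Longrightarrow> Lp_norm (ennreal r) M g = ennreal_powr (\<integral>\<^sup>+x. ennreal_powr (g x) r \<partial>M) (1 / r)"
  by (simp add: Lp_norm_def)

lemma Lp_norm_mono:
  assumes "0 < r" "\<And>x. x \<in> space M \<Longrightarrow> f x \<le> g x"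
  shows "Lp_norm (ennreal r) M f \<le> Lp_norm (ennreal r) M g"
  using assms by (auto simp: Lp_norm_ennreal intro!: ennreal_powr_mono nn_integral_mono)

lemma Lp_norm_le_iff:
  assumes "0 < r"
  shows "Lp_norm (ennreal r) M g \<le> B \<longleftrightarrow> (\<integral>\<^sup>+x. ennreal_powr (g x) r \<partial>M) \<le> ennreal_powr B r"
  using assms by (simp add: Lp_norm_ennreal ennreal_powr_le_iff)

lemma Lp_norm_cmult:
  assumes "0 < r" and [measurable]: "g \<in> borel_measurable M"
  shows "Lp_norm (ennreal r) M (\<lambda>x. c * g x) = c * Lp_norm (ennreal r) M g"
  using assms by (simp add: Lp_norm_ennreal ennreal_powr_mult nn_integral_cmult ennreal_powr_powr)

text \<open>Minkowski's inequality. If A and B exceed the two norms, the weighted inequality with t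
  = A/(A+B) bounds the integral of (f+g)^r by t^(1-r) A^r + (1-t)^(1-r) B^r, which equals
  (A+B)^r.\<close>

lemma Lp_norm_add:
  assumes r: "1 \<le> r" and [measurable]: "f \<in> borel_measurable M" "g \<in> borel_measurable M"
  shows "Lp_norm (ennreal r) M (\<lambda>x. f x + g x) \<le> Lp_norm (ennreal r) M f + Lp_norm (ennreal r) M g"
    (is "?N \<le> ?F + ?G")
proof (cases "?F = top \<or> ?G = top")
  case False
  then obtain F G where FG: "?F = ennreal F" "?G = ennreal G" "0 \<le> F" "0 \<le> G"
    by (cases ?F; cases ?G) auto
  \<comment> \<open>Strict inequalities keep A and B positive even when a norm vanishes, so that t
    lies strictly between 0 and 1. The bound F + G is recovered by letting A and B decrease to the
    norms.\<close>
  have *: "?N \<le> ennreal (A + B)" if AB: "F < A" "G < B" for A B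
  proof -
    define t where "t = A / (A + B)"
    have t: "0 < t" "t < 1" and t': "1 - t = B / (A + B)"
      using AB FG by (auto simp: t_def field_simps)
    have "(\<integral>\<^sup>+x. ennreal_powr (f x + g x) r \<partial>M)
      \<le> (\<integral>\<^sup>+x. ennreal (t powr (1 - r)) * ennreal_powr (f x) r
            + ennreal ((1 - t) powr (1 - r)) * ennreal_powr (g x) r \<partial>M)"
      by (intro nn_integral_mono ennreal_powr_add_le_weighted t r)
    also have "\<dots> = ennreal (t powr (1 - r)) * (\<integral>\<^sup>+x. ennreal_powr (f x) r \<partial>M)
            + ennreal ((1 - t) powr (1 - r)) * (\<integral>\<^sup>+x. ennreal_powr (g x) r \<partial>M)"
      by (simp add: nn_integral_add nn_integral_cmult)
    also have "\<dots> \<le> ennreal (t powr (1 - r)) * ennreal (A powr r)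
            + ennreal ((1 - t) powr (1 - r)) * ennreal (B powr r)"
    proof (intro add_mono mult_left_mono)
      have "?F \<le> ennreal A" "?G \<le> ennreal B" using FG AB by (auto intro: ennreal_leI)
      then show "(\<integral>\<^sup>+x. ennreal_powr (f x) r \<partial>M) \<le> ennreal (A powr r)"
        "(\<integral>\<^sup>+x. ennreal_powr (g x) r \<partial>M) \<le> ennreal (B powr r)"
        using r FG AB Lp_norm_le_iff[of r M f "ennreal A"] Lp_norm_le_iff[of r M g "ennreal B"]
        by simp_all
    qed auto
    also have "\<dots> = ennreal (t powr (1 - r) * A powr r + (1 - t) powr (1 - r) * B powr r)"
      by (simp flip: ennreal_plus ennreal_mult)
    also have "t powr (1 - r) * A powr r + (1 - t) powr (1 - r) * B powr r = (A + B) powr r"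
    proof -
      have "(c / (A + B)) powr (1 - r) * c powr r = c / (A + B) * (A + B) powr r"
        if "0 < c" for c
      proof -
        have "0 < A + B" using AB FG by simp
        moreover from this that have "(c / (A + B)) powr (1 - r)
            = c / (A + B) * ((A + B) powr r / c powr r)"
          by (simp add: powr_divide powr_diff)
        ultimately show ?thesis using that by simp
      qed
      then show ?thesis
        using AB FG unfolding t' by (simp add: t_def add_divide_distrib[symmetric] distrib_right[symmetric])
    qed
    finally show ?thesis using r FG AB by (subst Lp_norm_le_iff) (simp_all del: ennreal_plus)
  qed
  have "?N \<le> ennreal (F + G)"
  proof (rule ennreal_le_epsilon)
    fix e :: real assume e: "0 < e"
    have "F + e / 2 + (G + e / 2) = F + G + e" by simp
    with *[of "F + e / 2" "G + e / 2"] e have "?N \<le> ennreal (F + G + e)" by simp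
    also have "\<dots> = ennreal (F + G) + ennreal e" using FG e by (intro ennreal_plus) auto
    finally show "?N \<le> ennreal (F + G) + ennreal e" .
  qed
  then show ?thesis using FG by simp
qed auto

lemma Lp_norm_sum:
  assumes "1 \<le> r" "\<And>i::nat. g i \<in> borel_measurable M"
  shows "Lp_norm (ennreal r) M (\<lambda>x. \<Sum>i<n. g i x) \<le> (\<Sum>i<n. Lp_norm (ennreal r) M (g i))"
proof (induction n)
  case 0
  then show ?case using assms by (simp add: Lp_norm_ennreal)
next
  case (Suc n)
  have "Lp_norm (ennreal r) M (\<lambda>x. (\<Sum>i<n. g i x) + g n x)
     \<le> Lp_norm (ennreal r) M (\<lambda>x. \<Sum>i<n. g i x) + Lp_norm (ennreal r) M (g n)"
    using assms by (intro Lp_norm_add) measurable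
  with Suc show ?case by (auto intro: order_trans add_right_mono)
qed

text \<open>Monotone convergence carries Minkowski's inequality over to series; the dyadic pieces
  are summed this way.\<close>

lemma Lp_norm_suminf:
  assumes r: "1 \<le> r" and [measurable]: "\<And>i::nat. g i \<in> borel_measurable M"
  shows "Lp_norm (ennreal r) M (\<lambda>x. \<Sum>i. g i x) \<le> (\<Sum>i. Lp_norm (ennreal r) M (g i))" (is "_ \<le> ?S")
proof -
  have "(\<integral>\<^sup>+x. ennreal_powr (\<Sum>i. g i x) r \<partial>M)
      = (\<integral>\<^sup>+x. (SUP n. ennreal_powr (\<Sum>i<n. g i x) r) \<partial>M)"
    using r by (simp add: suminf_eq_SUP ennreal_powr_SUP)
  also have "\<dots> = (SUP n. \<integral>\<^sup>+x. ennreal_powr (\<Sum>i<n. g i x) r \<partial>M)"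
    using r by (intro nn_integral_monotone_convergence_SUP)
      (auto intro!: incseq_SucI le_funI ennreal_powr_mono)
  also have "\<dots> \<le> ennreal_powr ?S r"
  proof (intro SUP_least)
    fix n
    have "Lp_norm (ennreal r) M (\<lambda>x. \<Sum>i<n. g i x) \<le> (\<Sum>i<n. Lp_norm (ennreal r) M (g i))"
      using r by (intro Lp_norm_sum) auto
    also have "\<dots> \<le> ?S" by (intro sum_le_suminf) auto
    finally show "(\<integral>\<^sup>+x. ennreal_powr (\<Sum>i<n. g i x) r \<partial>M) \<le> ennreal_powr ?S r"
      using r by (simp add: Lp_norm_le_iff)
  qed
  finally show ?thesis using r by (simp add: Lp_norm_le_iff)
qed

text \<open>The comparison uses \<open>u\<^sup>q \<le> 1 + u\<^sup>r\<close>; hence the summand \<open>1\<close> in the constant.\<close>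
lemma Lp_norm_le_of_larger_exponent:
  assumes qr: "0 < q" "q \<le> r" and B: "0 < B" and [measurable]: "g \<in> borel_measurable M"
    and g: "Lp_norm (ennreal r) M g \<le> ennreal B"
  shows "Lp_norm (ennreal q) M g \<le> ennreal_powr (emeasure M (space M) + 1) (1 / q) * ennreal B"
proof -
  have pt: "ennreal_powr u q \<le> ennreal (B powr q) * (1 + ennreal (B powr (- r)) * ennreal_powr u r)" for u
  proof (cases u)
    case (real v)
    have "(v / B) powr q \<le> 1 + (v / B) powr r"
    proof (cases "v / B \<le> 1")
      case True
      then have "(v / B) powr q \<le> 1" using real B qr by (intro powr_le1) auto
      then show ?thesis by (smt (verit) powr_ge_zero)
    next
      case False
      then have "(v / B) powr q \<le> (v / B) powr r" using qr by (intro powr_mono) auto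
      then show ?thesis by simp
    qed
    then have "v powr q \<le> B powr q * (1 + B powr (- r) * v powr r)"
      using real B by (simp add: powr_divide powr_minus field_simps)
    then show ?thesis using real
      by (simp flip: ennreal_mult ennreal_plus ennreal_1)
  next
    case top
    then show ?thesis using B by (simp add: ennreal_mult_top)
  qed
  have "(\<integral>\<^sup>+x. ennreal_powr (g x) q \<partial>M)
     \<le> (\<integral>\<^sup>+x. ennreal (B powr q) * (1 + ennreal (B powr (- r)) * ennreal_powr (g x) r) \<partial>M)"
    by (intro nn_integral_mono pt)
  also have "\<dots> = ennreal (B powr q) * (emeasure M (space M)
      + ennreal (B powr (- r)) * (\<integral>\<^sup>+x. ennreal_powr (g x) r \<partial>M))"
    by (simp add: nn_integral_cmult nn_integral_add)
  also have "\<dots> \<le> ennreal (B powr q) * (emeasure M (space M)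
      + ennreal (B powr (- r)) * ennreal (B powr r))"
    using g qr B by (intro mult_left_mono add_left_mono) (auto simp: Lp_norm_le_iff)
  also have "\<dots> = ennreal (B powr q) * (emeasure M (space M) + 1)"
    using B by (simp add: powr_minus flip: ennreal_mult)
  finally show ?thesis
    using qr B by (simp add: Lp_norm_le_iff ennreal_powr_mult ennreal_powr_powr mult.commute)
qed

section \<open>Rotated coordinates in the plane\<close>

text \<open>The quarter turn is a choice of perpendicular vector that is linear in \<open>w\<close>,
  hence Borel, whereas an arbitrary \<open>perp\<close> may fail to be measurable.\<close>

definition rot :: "real^2 \<Rightarrow> real^2" where
  "rot w = (\<chi> i. if i = 1 then - (w $ 2) else w $ 1)"

lemma rot_nth [simp]: "rot w $ 1 = - (w $ 2)" "rot w $ 2 = w $ 1"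
  by (simp_all add: rot_def)

lemma linear_rot: "linear rot"
  by (rule linearI) (simp_all add: vec_eq_iff forall_2)

lemma borel_measurable_rot [measurable]: "rot \<in> borel_measurable borel"
  by (intro borel_measurable_continuous_onI linear_continuous_on)
    (simp add: linear_rot flip: linear_conv_bounded_linear)

lemma inner_vec2: "(x :: real^2) \<bullet> y = x $ 1 * y $ 1 + x $ 2 * y $ 2"
  by (simp add: inner_vec_def sum_2)

lemma inner_rot [simp]: "rot w \<bullet> rot w = w \<bullet> w" "w \<bullet> rot w = 0" "rot w \<bullet> w = 0"
  by (simp_all add: inner_vec2)

text \<open>Lebesgue measure is determined by its values on boxes. This turns plane integrals into
  iterated ones.\<close>

lemma lborel_vec2: "distr (lborel \<Otimes>\<^sub>M lborel) borel (\<lambda>(a, b). vector [a, b] :: real^2) = lborel"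
  (is "?D = _")
proof (rule lborel_eqI[symmetric])
  have v: "(vector [a, b] :: real^2) = a *\<^sub>R axis 1 1 + b *\<^sub>R axis 2 1" for a b
    by (simp add: vec_eq_iff forall_2 axis_def)
  have [measurable]: "(\<lambda>(a, b). vector [a, b] :: real^2) \<in> borel_measurable (lborel \<Otimes>\<^sub>M lborel)"
    unfolding v by measurable
  show "sets ?D = sets borel" by simp
  fix l u :: "real^2"
  assume lu: "\<And>b. b \<in> Basis \<Longrightarrow> l \<bullet> b \<le> u \<bullet> b"
  have B: "axis i 1 \<in> (Basis :: (real^2) set)" for i
    by (simp add: axis_in_Basis_iff)
  have lu': "l $ i \<le> u $ i" for i
    using lu[OF B[of i]] by (simp add: inner_axis)
  have "emeasure ?D (box l u) = emeasure (lborel \<Otimes>\<^sub>M lborel) ({l$1<..<u$1} \<times> {l$2<..<u$2})"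
    by (subst emeasure_distr)
      (auto simp: mem_box_cart forall_2 space_pair_measure intro!: arg_cong2[where f=emeasure])
  also have "\<dots> = ennreal ((u$1 - l$1) * (u$2 - l$2))"
    by (simp add: lborel.emeasure_pair_measure_Times lu' ennreal_mult)
  also have "(u$1 - l$1) * (u$2 - l$2) = (\<Prod>b\<in>Basis. (u - l) \<bullet> b)"
  proof -
    have Basis: "(Basis :: (real^2) set) = (\<lambda>i. axis i 1) ` UNIV"
      by (auto simp: Basis_vec_def)
    have inj: "inj (\<lambda>i::2. axis i (1::real))"
      by (auto intro: injI simp: axis_eq_axis)
    have "(\<Prod>b\<in>Basis. (u - l) \<bullet> b) = (\<Prod>i\<in>UNIV. (u - l) \<bullet> axis i 1)"
      unfolding Basis by (rule prod.reindex[OF inj, unfolded o_def])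
    then show ?thesis by (simp add: UNIV_2 inner_axis)
  qed
  finally show "emeasure ?D (box l u) = (\<Prod>b\<in>Basis. (u - l) \<bullet> b)" .
qed

text \<open>If c is nonzero, the rotation is composed of two affine substitutions in one variable,
  separated by Fubini: b = (a s + u)/c for fixed a, then a = c t - s u for fixed u. Their factors
  1/|c| and |c| cancel. If c = 0, the axes are merely exchanged up to sign.\<close>

lemma nn_integral_rotate_coordinates:
  fixes c s :: real and G :: "real \<Rightarrow> real \<Rightarrow> ennreal"
  assumes cs: "c\<^sup>2 + s\<^sup>2 = 1"
    and [measurable]: "(\<lambda>(a, b). G a b) \<in> borel_measurable borel"
  shows "(\<integral>\<^sup>+t. \<integral>\<^sup>+u. G (t * c - u * s) (t * s + u * c) \<partial>lborel \<partial>lborel)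
    = (\<integral>\<^sup>+a. \<integral>\<^sup>+b. G a b \<partial>lborel \<partial>lborel)"
proof -
  have m [measurable (raw)]:
    "(\<lambda>x. G (f x) (g x)) \<in> borel_measurable M"
    if [measurable]: "f \<in> borel_measurable M" "g \<in> borel_measurable M" for f g and M :: "'z measure"
    using measurable_compose[of "\<lambda>x. (f x, g x)" M borel "\<lambda>(a, b). G a b" borel] by simp
  show ?thesis
  proof (cases "c = 0")
    case False
    have "(\<integral>\<^sup>+a. \<integral>\<^sup>+b. G a b \<partial>lborel \<partial>lborel)
      = (\<integral>\<^sup>+a. \<bar>1 / c\<bar> * (\<integral>\<^sup>+u. G a (a * s / c + 1 / c * u) \<partial>lborel) \<partial>lborel)"
      using False by (intro nn_integral_cong nn_integral_real_affine) auto
    also have "\<dots> = \<bar>1 / c\<bar> * (\<integral>\<^sup>+a. \<integral>\<^sup>+u. G a (a * s / c + 1 / c * u) \<partial>lborel \<partial>lborel)"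
      by (intro nn_integral_cmult) measurable
    also have "(\<integral>\<^sup>+a. \<integral>\<^sup>+u. G a (a * s / c + 1 / c * u) \<partial>lborel \<partial>lborel)
      = (\<integral>\<^sup>+u. \<integral>\<^sup>+a. G a (a * s / c + 1 / c * u) \<partial>lborel \<partial>lborel)"
      by (intro lborel_pair.Fubini') measurable
    also have "\<dots> = (\<integral>\<^sup>+u. \<bar>c\<bar> * (\<integral>\<^sup>+t. G (- u * s + c * t)
          ((- u * s + c * t) * s / c + 1 / c * u) \<partial>lborel) \<partial>lborel)"
      using False by (intro nn_integral_cong nn_integral_real_affine) measurable
    also have "\<dots> = \<bar>c\<bar> * (\<integral>\<^sup>+u. \<integral>\<^sup>+t. G (- u * s + c * t)
          ((- u * s + c * t) * s / c + 1 / c * u) \<partial>lborel \<partial>lborel)"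
      by (intro nn_integral_cmult) measurable
    also have "(\<integral>\<^sup>+u. \<integral>\<^sup>+t. G (- u * s + c * t) ((- u * s + c * t) * s / c + 1 / c * u) \<partial>lborel \<partial>lborel)
       = (\<integral>\<^sup>+u. \<integral>\<^sup>+t. G (t * c - u * s) (t * s + u * c) \<partial>lborel \<partial>lborel)"
    proof (intro nn_integral_cong arg_cong2[where f=G])
      fix t u
      have "(- u * s + c * t) * s + u = c * (t * s) + u * (1 - s\<^sup>2)"
        by (simp add: algebra_simps power2_eq_square)
      also have "1 - s\<^sup>2 = c * c" using cs by (simp add: power2_eq_square)
      finally have "(- u * s + c * t) * s + u = (t * s + u * c) * c" by (simp add: algebra_simps)
      then show "(- u * s + c * t) * s / c + 1 / c * u = t * s + u * c"
        using False by (simp add: field_simps)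
    qed (simp add: mult.commute)
    also have "\<dots> = (\<integral>\<^sup>+t. \<integral>\<^sup>+u. G (t * c - u * s) (t * s + u * c) \<partial>lborel \<partial>lborel)"
      by (intro lborel_pair.Fubini') measurable
    finally show ?thesis
      using False by (simp add: mult.assoc[symmetric] flip: ennreal_mult)
  next
    case True
    with cs have s: "s = 1 \<or> s = -1" by (simp add: power2_eq_1_iff)
    then have [simp]: "s \<noteq> 0" "\<bar>s\<bar> = 1" by auto
    have "(\<integral>\<^sup>+a. \<integral>\<^sup>+b. G a b \<partial>lborel \<partial>lborel) = (\<integral>\<^sup>+b. \<integral>\<^sup>+a. G a b \<partial>lborel \<partial>lborel)"
      by (intro lborel_pair.Fubini') measurable
    also have "\<dots> = \<bar>s\<bar> * (\<integral>\<^sup>+t. \<integral>\<^sup>+a. G a (0 + s * t) \<partial>lborel \<partial>lborel)"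
      by (rule nn_integral_real_affine) auto
    also have "\<dots> = \<bar>s\<bar> * (\<integral>\<^sup>+t. \<bar>-s\<bar> * (\<integral>\<^sup>+u. G (0 + (- s) * u) (0 + s * t) \<partial>lborel) \<partial>lborel)"
      by (intro arg_cong2[where f="(*)"] nn_integral_cong nn_integral_real_affine refl) auto
    finally show ?thesis using True by (simp add: mult.commute)
  qed
qed

lemma nn_integral_lborel_rot:
  fixes g :: "real^2 \<Rightarrow> ennreal"
  assumes [measurable]: "g \<in> borel_measurable borel" and w: "norm w = 1"
  shows "(\<integral>\<^sup>+x. g x \<partial>lborel) = (\<integral>\<^sup>+t. \<integral>\<^sup>+u. g (t *\<^sub>R w + u *\<^sub>R rot w) \<partial>lborel \<partial>lborel)"
proof -
  have v: "(vector [a, b] :: real^2) = a *\<^sub>R axis 1 1 + b *\<^sub>R axis 2 1" for a b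
    by (simp add: vec_eq_iff forall_2 axis_def)
  have [measurable]: "(\<lambda>x :: real \<times> real. vector [fst x, snd x] :: real^2) \<in> borel_measurable borel"
    unfolding v by (intro borel_measurable_continuous_onI continuous_intros)
  have [measurable]: "(\<lambda>(a, b). g (vector [a, b])) \<in> borel_measurable borel"
    unfolding split_beta' by measurable
  have "(\<integral>\<^sup>+x. g x \<partial>lborel) = (\<integral>\<^sup>+x. g x \<partial>distr (lborel \<Otimes>\<^sub>M lborel) borel (\<lambda>(a, b). vector [a, b] :: real^2))"
    by (simp add: lborel_vec2)
  also have "\<dots> = (\<integral>\<^sup>+ab. (case ab of (a, b) \<Rightarrow> g (vector [a, b])) \<partial>(lborel \<Otimes>\<^sub>M lborel))"
    by (subst nn_integral_distr) (auto simp: split_beta' lborel_prod)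
  also have "\<dots> = (\<integral>\<^sup>+a. \<integral>\<^sup>+b. g (vector [a, b]) \<partial>lborel \<partial>lborel)"
    by (subst lborel.nn_integral_fst[symmetric]) (auto simp: lborel_prod)
  also have "\<dots> = (\<integral>\<^sup>+t. \<integral>\<^sup>+u. g (vector [t * w$1 - u * w$2, t * w$2 + u * w$1]) \<partial>lborel \<partial>lborel)"
  proof (rule nn_integral_rotate_coordinates[symmetric])
    have "w \<bullet> w = 1" using w by (simp add: dot_square_norm)
    then show "(w $ 1)\<^sup>2 + (w $ 2)\<^sup>2 = 1" by (simp add: inner_vec2 power2_eq_square)
  qed measurable
  also have "(\<lambda>t u. vector [t * w$1 - u * w$2, t * w$2 + u * w$1]) = (\<lambda>t u. t *\<^sub>R w + u *\<^sub>R rot w)"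
    by (simp add: fun_eq_iff vec_eq_iff forall_2)
  finally show ?thesis by (simp add: fun_eq_iff)
qed

text \<open>In the coordinates x = t w + u \<open>rot w\<close>, the first condition restricts t
  alone, and for fixed t the product x . w' is affine in u with slope
  \<open>rot w \<bullet> w'\<close>. For unit vectors this slope is the sine of the angle; keeping
  it on the left avoids dividing by zero for parallel directions.\<close>

lemma emeasure_strips_Int_le:
  assumes [measurable]: "S \<in> sets borel" "S' \<in> sets borel" and w: "norm w = 1"
  shows "ennreal \<bar>rot w \<bullet> w'\<bar> * emeasure lborel {x. x \<bullet> w \<in> S \<and> x \<bullet> w' \<in> S'}
    \<le> emeasure lborel S * emeasure lborel S'"
proof (cases "rot w \<bullet> w' = 0")
  case False
  have ww: "w \<bullet> w = 1" using w by (simp add: dot_square_norm)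
  define d where "d = rot w \<bullet> w'"
  have "d \<noteq> 0" using False by (simp add: d_def)
  have "emeasure lborel {x. x \<bullet> w \<in> S \<and> x \<bullet> w' \<in> S'}
     = (\<integral>\<^sup>+x. indicator {x. x \<bullet> w \<in> S \<and> x \<bullet> w' \<in> S'} x \<partial>lborel)"
    by (rule nn_integral_indicator[symmetric]) simp
  also have "\<dots> = (\<integral>\<^sup>+x. indicator S (x \<bullet> w) * indicator S' (x \<bullet> w') \<partial>lborel)"
    by (intro nn_integral_cong) (simp add: indicator_def)
  also have "\<dots> = (\<integral>\<^sup>+t. \<integral>\<^sup>+u. indicator S t * indicator S' (t * (w \<bullet> w') + d * u) \<partial>lborel \<partial>lborel)"
    by (subst nn_integral_lborel_rot[OF _ w]) (simp_all add: inner_add_left ww d_def mult.commute)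
  also have "\<dots> = (\<integral>\<^sup>+t. indicator S t * (\<integral>\<^sup>+u. indicator S' (t * (w \<bullet> w') + d * u) \<partial>lborel) \<partial>lborel)"
    by (intro nn_integral_cong nn_integral_cmult) auto
  finally have "ennreal \<bar>d\<bar> * emeasure lborel {x. x \<bullet> w \<in> S \<and> x \<bullet> w' \<in> S'}
     = ennreal \<bar>d\<bar> * (\<integral>\<^sup>+t. indicator S t * (\<integral>\<^sup>+u. indicator S' (t * (w \<bullet> w') + d * u) \<partial>lborel) \<partial>lborel)"
    by simp
  also have "\<dots> = (\<integral>\<^sup>+t. indicator S t * (ennreal \<bar>d\<bar> * (\<integral>\<^sup>+u. indicator S' (t * (w \<bullet> w') + d * u) \<partial>lborel)) \<partial>lborel)"
    by (subst nn_integral_cmult[symmetric]) (auto simp: mult_ac)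
  also have "\<dots> = (\<integral>\<^sup>+t. indicator S t * emeasure lborel S' \<partial>lborel)"
    using \<open>d \<noteq> 0\<close> by (subst nn_integral_real_affine[symmetric]) auto
  also have "\<dots> = emeasure lborel S * emeasure lborel S'"
    by (simp add: nn_integral_multc)
  finally show ?thesis by (simp add: d_def)
qed simp

section \<open>Small angles\<close>

text \<open>The measure lives on the plane, where Borel sets of \<open>real^2\<close> are available;
  it will be the image of the given measure under the inclusion of the circle. The locale does not
  force it to be concentrated on the circle, hence the indicators of \<open>unit_circle\<close> in
  the integrals.\<close>

locale circle_measure = finite_measure \<nu> for \<nu> :: "(real^2) measure" +
  fixes \<alpha> C :: real
  assumes sets_nu [measurable_cong, simp]: "sets \<nu> = sets borel"
    and alpha: "0 < \<alpha>" "\<alpha> < 1"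
    and C_nonneg: "0 \<le> C"
    and ball_bound: "norm w = 1 \<Longrightarrow> 0 < \<delta> \<Longrightarrow> emeasure \<nu> (ball w \<delta>) \<le> ennreal (C * \<delta> powr \<alpha>)"
begin

lemma space_nu [simp]: "space \<nu> = UNIV"
  using sets_eq_imp_space_eq[OF sets_nu] by simp

end

text \<open>Let v be whichever of w and -w satisfies v . w' \<ge> 0. Then |v - w'|^2 = 2 (1 - v .
  w') \<le> 2 (1 - v . w') (1 + v . w'), and the right-hand side is twice the squared sine, hence
  below 4 r^2.\<close>

lemma near_of_small_angle:
  fixes w w' :: "real^2"
  assumes w: "norm w = 1" "norm w' = 1" and r: "\<bar>rot w \<bullet> w'\<bar> < r"
  shows "w' \<in> ball w (2 * r) \<union> ball (- w) (2 * r)"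
proof -
  have one: "w \<bullet> w = 1" "w' \<bullet> w' = 1" using w by (simp_all add: dot_square_norm)
  have r0: "0 < r" using r by linarith
  have "(w \<bullet> w')\<^sup>2 + (rot w \<bullet> w')\<^sup>2 = (w \<bullet> w) * (w' \<bullet> w')"
    by (simp add: inner_vec2 power2_eq_square algebra_simps)
  then have sq: "(rot w \<bullet> w')\<^sup>2 = 1 - (w \<bullet> w')\<^sup>2" by (simp add: one)
  have dr: "(rot w \<bullet> w')\<^sup>2 < r\<^sup>2"
    using power_strict_mono[OF r abs_ge_zero, of 2] by simp
  have main: "norm (v - w') < 2 * r"
    if v: "v \<bullet> v = 1" "0 \<le> v \<bullet> w'" "(v \<bullet> w')\<^sup>2 = (w \<bullet> w')\<^sup>2" for v
  proof -
    have "(norm (v - w'))\<^sup>2 = 2 * (1 - v \<bullet> w')"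
      by (simp add: power2_norm_eq_inner inner_diff_left inner_diff_right inner_commute v one)
    also have "\<dots> \<le> 2 * ((1 - v \<bullet> w') * (1 + v \<bullet> w'))"
    proof -
      have "\<bar>v \<bullet> w'\<bar> \<le> norm v * norm w'" by (rule Cauchy_Schwarz_ineq2)
      also have "norm v = 1" using v by (simp add: norm_eq_1)
      finally have "v \<bullet> w' \<le> 1" using w by simp
      then have "(1 - v \<bullet> w') * 1 \<le> (1 - v \<bullet> w') * (1 + v \<bullet> w')"
        using v by (intro mult_left_mono) auto
      then show ?thesis by simp
    qed
    also have "\<dots> = 2 * (rot w \<bullet> w')\<^sup>2"
      unfolding sq v(3)[symmetric] by (simp add: power2_eq_square algebra_simps)
    also have "\<dots> < (2 * r)\<^sup>2"
    proof -
      have "(2 * r)\<^sup>2 = 4 * r\<^sup>2" by simp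
      with dr zero_less_power[OF r0, of 2] show ?thesis by linarith
    qed
    finally show ?thesis by (rule power2_less_imp_less) (use r0 in simp)
  qed
  show ?thesis
  proof (cases "0 \<le> w \<bullet> w'")
    case True
    with main[of w] show ?thesis by (simp add: one dist_norm)
  next
    case False
    with main[of "- w"] show ?thesis by (simp add: one dist_norm)
  qed
qed

text \<open>Up to constants, \<open>dyadic_kernel b M D\<close> is \<open>min M (b / D)\<close>.\<close>
definition dyadic_kernel :: "real \<Rightarrow> real \<Rightarrow> real \<Rightarrow> ennreal" where
  "dyadic_kernel b M D = (\<Sum>m. ennreal (2 * M * (1 / 2) ^ m) * indicator {..< 2 ^ m * (b / M)} D)"

lemma borel_measurable_dyadic_kernel [measurable (raw)]:
  assumes [measurable]: "f \<in> borel_measurable M'" "b \<in> borel_measurable M'"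
  shows "(\<lambda>x. dyadic_kernel (b x) M (f x)) \<in> borel_measurable M'"
  unfolding dyadic_kernel_def indicator_def lessThan_iff by measurable

lemma le_suminf: "f m \<le> (\<Sum>n. f n)" for f :: "nat \<Rightarrow> ennreal"
  using sum_le_suminf[of f "{m}"] by simp

text \<open>Take the least m with D < 2^m b/M. For m = 0 the first bound suffices; otherwise D \<ge>
  2^(m-1) b/M by minimality, and the second bound gives X \<le> 2 M c 2^(-m). Either way the m-th
  term of the kernel alone dominates.\<close>

lemma le_dyadic_kernel:
  assumes pos: "0 < b" "0 < M" "0 \<le> c" "0 \<le> D"
    and X1: "X \<le> ennreal (M * c)" and X2: "ennreal D * X \<le> ennreal (b * c)"
  shows "X \<le> ennreal c * dyadic_kernel b M D"
proof -
  obtain x where x: "X = ennreal x" "0 \<le> x" using X1 by (cases X) (auto simp: top_unique)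
  have x1: "x \<le> M * c" and x2: "D * x \<le> b * c"
    using X1 X2 x pos by (simp_all flip: ennreal_mult)
  obtain N where "D / (b / M) < 2 ^ N"
    using real_arch_pow[of 2 "D / (b / M)"] by auto
  then have N: "D < 2 ^ N * (b / M)" using pos by (simp add: field_simps)
  define m where "m = (LEAST m. D < 2 ^ m * (b / M))"
  have m: "D < 2 ^ m * (b / M)" unfolding m_def by (rule LeastI[of _ N]) (rule N)
  have "x \<le> c * (2 * M * (1 / 2) ^ m)"
  proof (cases m)
    case 0
    have "0 \<le> M * c" using pos by simp
    with x1 have "x \<le> 2 * (M * c)" by linarith
    then show ?thesis using 0 by (simp add: mult_ac)
  next
    case (Suc k)
    then have "\<not> D < 2 ^ k * (b / M)" using not_less_Least[of k "\<lambda>m. D < 2 ^ m * (b / M)"]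
      by (simp add: m_def)
    then have "2 ^ k * (b / M) * x \<le> D * x" using x by (intro mult_right_mono) auto
    also note x2
    finally have "2 ^ k * x \<le> M * c" using pos by (simp add: field_simps)
    then show ?thesis using Suc by (simp add: field_simps power_divide)
  qed
  then have "X \<le> ennreal c * (ennreal (2 * M * (1 / 2) ^ m) * indicator {..< 2 ^ m * (b / M)} D)"
    using x m pos by (simp add: ennreal_leI flip: ennreal_mult)
  also have "\<dots> \<le> ennreal c * dyadic_kernel b M D"
    unfolding dyadic_kernel_def
    by (intro mult_left_mono le_suminf) auto
  finally show ?thesis .
qed

context circle_measure
begin

text \<open>The sine is small near \<open>w\<close> and near \<open>- w\<close>; the two balls
  account for the factor 2.\<close>

lemma emeasure_small_angle_le:
  assumes w: "norm w = 1" and r: "0 < r"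
  shows "emeasure \<nu> {w'. norm w' = 1 \<and> \<bar>rot w \<bullet> w'\<bar> < r} \<le> ennreal (2 * C * (2 * r) powr \<alpha>)"
proof -
  have "emeasure \<nu> {w'. norm w' = 1 \<and> \<bar>rot w \<bullet> w'\<bar> < r}
     \<le> emeasure \<nu> (ball w (2 * r) \<union> ball (- w) (2 * r))"
  proof (rule emeasure_mono)
    show "{w'. norm w' = 1 \<and> \<bar>rot w \<bullet> w'\<bar> < r} \<subseteq> ball w (2 * r) \<union> ball (- w) (2 * r)"
    proof
      fix w' assume "w' \<in> {w'. norm w' = 1 \<and> \<bar>rot w \<bullet> w'\<bar> < r}"
      then show "w' \<in> ball w (2 * r) \<union> ball (- w) (2 * r)"
        by (intro near_of_small_angle w) auto
    qed
  qed simp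
  also have "\<dots> \<le> emeasure \<nu> (ball w (2 * r)) + emeasure \<nu> (ball (- w) (2 * r))"
    by (intro emeasure_subadditive) auto
  also have "\<dots> \<le> ennreal (C * (2 * r) powr \<alpha>) + ennreal (C * (2 * r) powr \<alpha>)"
    using w r by (intro add_mono ball_bound) auto
  also have "\<dots> = ennreal (2 * C * (2 * r) powr \<alpha>)"
    using C_nonneg by (subst ennreal_plus[symmetric]) auto
  finally show ?thesis .
qed

text \<open>The m-th term of the kernel has height 2 M 2^(-m) and lives on a set of measure at most
  2 C (2 2^m b/M)^\<alpha>. This leaves 4 C 2^\<alpha> times the sum of the powers of
  2^(\<alpha>-1).\<close>

definition kernel_const :: real where
  "kernel_const = 4 * C * 2 powr \<alpha> / (1 - 2 powr (\<alpha> - 1))"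

lemma kernel_const_nonneg: "0 \<le> kernel_const"
proof -
  have "2 powr (\<alpha> - 1) < 2 powr (0::real)" using alpha by (intro powr_less_mono) auto
  then show ?thesis using C_nonneg by (simp add: kernel_const_def)
qed

text \<open>The measure bounds grow like 2^(\<alpha> m) while the heights decay like 2^(-m), so
  \<open>\<alpha> < 1\<close> makes the series geometric with ratio below 1.\<close>

lemma nn_integral_dyadic_kernel_le:
  assumes w: "norm w = 1" and pos: "0 < b" "0 < M"
  shows "(\<integral>\<^sup>+w'. dyadic_kernel b M \<bar>rot w \<bullet> w'\<bar> * indicator unit_circle w' \<partial>\<nu>)
    \<le> ennreal (kernel_const * M * (b / M) powr \<alpha>)"
proof -
  define c where "c = 2 powr (\<alpha> - 1)"
  have c: "0 < c" "c < 1"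
    using alpha powr_less_mono[of "\<alpha> - 1" 0 2] by (auto simp: c_def)
  have [measurable]: "unit_circle \<in> sets (borel :: (real^2) measure)" by simp
  have term_le: "(\<integral>\<^sup>+w'. ennreal (2 * M * (1 / 2) ^ m) *
      indicator {w'. norm w' = 1 \<and> \<bar>rot w \<bullet> w'\<bar> < 2 ^ m * (b / M)} w' \<partial>\<nu>)
    \<le> ennreal (4 * C * 2 powr \<alpha> * M * (b / M) powr \<alpha> * c ^ m)" (is "?L \<le> _") for m
  proof -
    have "?L = ennreal (2 * M * (1 / 2) ^ m) *
        emeasure \<nu> {w'. norm w' = 1 \<and> \<bar>rot w \<bullet> w'\<bar> < 2 ^ m * (b / M)}"
      by (intro nn_integral_cmult_indicator) simp
    also have "\<dots> \<le> ennreal (2 * M * (1 / 2) ^ m) * ennreal (2 * C * (2 * (2 ^ m * (b / M))) powr \<alpha>)"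
      using pos by (intro mult_left_mono emeasure_small_angle_le w) auto
    also have "\<dots> = ennreal (2 * M * (1 / 2) ^ m * (2 * C * (2 * (2 ^ m * (b / M))) powr \<alpha>))"
      using pos C_nonneg by (intro ennreal_mult[symmetric]) auto
    also have "(2 * (2 ^ m * (b / M))) powr \<alpha> = 2 powr \<alpha> * ((2 ^ m) powr \<alpha> * (b / M) powr \<alpha>)"
    proof -
      have "(2 ^ m * (b / M)) powr \<alpha> = (2 ^ m) powr \<alpha> * (b / M) powr \<alpha>" by (rule powr_mult)
      moreover have "(2 * (2 ^ m * (b / M))) powr \<alpha> = 2 powr \<alpha> * (2 ^ m * (b / M)) powr \<alpha>" by (rule powr_mult)
      ultimately show ?thesis by simp
    qed
    also have "2 * M * (1 / 2) ^ m * (2 * C * (2 powr \<alpha> * ((2 ^ m) powr \<alpha> * (b / M) powr \<alpha>)))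
        = 4 * C * 2 powr \<alpha> * M * (b / M) powr \<alpha> * ((2 ^ m) powr \<alpha> * (1 / 2) ^ m)"
      by simp
    also have "(2 ^ m) powr \<alpha> * (1 / 2) ^ m = c ^ m"
      by (simp add: c_def powr_diff power_divide powr_power flip: powr_realpow)
        (simp add: powr_powr mult.commute)
    finally show ?thesis .
  qed
  have "(\<integral>\<^sup>+w'. dyadic_kernel b M \<bar>rot w \<bullet> w'\<bar> * indicator unit_circle w' \<partial>\<nu>)
     = (\<integral>\<^sup>+w'. (\<Sum>m. ennreal (2 * M * (1 / 2) ^ m) *
      indicator {w'. norm w' = 1 \<and> \<bar>rot w \<bullet> w'\<bar> < 2 ^ m * (b / M)} w') \<partial>\<nu>)"
    unfolding dyadic_kernel_def ennreal_suminf_multc[symmetric]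
    by (intro nn_integral_cong suminf_cong) (auto simp: indicator_def)
  also have "\<dots> = (\<Sum>m. \<integral>\<^sup>+w'. ennreal (2 * M * (1 / 2) ^ m) *
      indicator {w'. norm w' = 1 \<and> \<bar>rot w \<bullet> w'\<bar> < 2 ^ m * (b / M)} w' \<partial>\<nu>)"
    by (intro nn_integral_suminf) measurable
  also have "\<dots> \<le> (\<Sum>m. ennreal (4 * C * 2 powr \<alpha> * M * (b / M) powr \<alpha> * c ^ m))"
    by (intro suminf_le term_le) auto
  also have "\<dots> = ennreal (4 * C * 2 powr \<alpha> * M * (b / M) powr \<alpha> * (1 / (1 - c)))"
  proof (intro suminf_ennreal_eq sums_mult geometric_sums)
    show "norm c < 1" using c by simp
  qed (use c C_nonneg pos in auto)
  also have "4 * C * 2 powr \<alpha> * M * (b / M) powr \<alpha> * (1 / (1 - c)) = kernel_const * M * (b / M) powr \<alpha>"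
    by (simp add: kernel_const_def c_def)
  finally show ?thesis .
qed

end

section \<open>The estimate for the indicator of a set\<close>

text \<open>The nonnegative counterpart of \<open>radon rot\<close>: with values in [0,\<infinity>]
  it is meaningful on every line.\<close>

definition xray :: "(real^2 \<Rightarrow> ennreal) \<Rightarrow> real^2 \<Rightarrow> real \<Rightarrow> ennreal" where
  "xray g w t = (\<integral>\<^sup>+u. g (t *\<^sub>R w + u *\<^sub>R rot w) * indicator {-1..1} u \<partial>lborel)"

lemma borel_measurable_xray [measurable (raw)]:
  assumes [measurable]: "g \<in> borel_measurable borel" "w \<in> borel_measurable M" "t \<in> borel_measurable M"
  shows "(\<lambda>x. xray g (w x) (t x)) \<in> borel_measurable M"
  unfolding xray_def by measurable

context circle_measure
begin

section \<open>One set \<open>E\<close> and one family \<open>T\<close> of lines on which its X-ray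
  transform is comparable to \<open>\<rho>\<close>\<close>

context
  fixes E :: "(real^2) set" and T :: "(real \<times> (real^2)) set" and \<rho> :: real
  assumes E [measurable]: "E \<in> sets borel"
    and T [measurable]: "T \<in> sets (borel \<Otimes>\<^sub>M borel)"
    and rho: "0 < \<rho>"
    and T_unit: "\<And>t w. (t, w) \<in> T \<Longrightarrow> norm w = 1"
    and T_le_1: "\<And>t w. (t, w) \<in> T \<Longrightarrow> \<bar>t\<bar> \<le> 1"
    and T_lower: "\<And>t w. (t, w) \<in> T \<Longrightarrow> ennreal \<rho> \<le> xray (indicator E) w t"
    and T_upper: "\<And>t w. (t, w) \<in> T \<Longrightarrow> xray (indicator E) w t \<le> ennreal (2 * \<rho>)"
begin

definition slice_length :: "real^2 \<Rightarrow> real" where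
  "slice_length w = measure lborel {t. (t, w) \<in> T}"

text \<open>For unit \<open>w\<close> the two inner products are the coordinates of \<open>x\<close>
  in the frame w, \<open>rot w\<close>. In \<open>x\<close> this is thus the indicator of the part
  of \<open>E\<close> on the segments that \<open>T\<close> selects for \<open>w\<close>.\<close>

definition strip :: "real^2 \<Rightarrow> real^2 \<Rightarrow> ennreal" where
  "strip x w = indicator E x * indicator T (x \<bullet> w, w) * indicator {-1..1} (x \<bullet> rot w)"

lemma measurable_strip [measurable (raw)]:
  assumes [measurable]: "f \<in> borel_measurable M" "g \<in> borel_measurable M"
  shows "(\<lambda>x. strip (f x) (g x)) \<in> borel_measurable M"
  unfolding strip_def by measurable

lemma slice_measurable [measurable]: "{t. (t, w) \<in> T} \<in> sets borel"
  by measurable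

lemma emeasure_slice: "emeasure lborel {t. (t, w) \<in> T} = ennreal (slice_length w)"
proof -
  have "emeasure lborel {t. (t, w) \<in> T} \<le> emeasure lborel {-1..1::real}"
    by (intro emeasure_mono) (auto dest!: T_le_1 simp: abs_le_iff)
  also have "\<dots> < \<infinity>" by simp
  finally show ?thesis
    unfolding slice_length_def by (intro emeasure_eq_ennreal_measure) auto
qed

lemma slice_length_nonneg [simp]: "0 \<le> slice_length w"
  by (simp add: slice_length_def)

lemma slice_length_le: "slice_length w \<le> 2"
proof -
  have "ennreal (slice_length w) \<le> emeasure lborel {-1..1::real}"
    unfolding emeasure_slice[symmetric]
    by (intro emeasure_mono) (auto dest!: T_le_1 simp: abs_le_iff)
  then have "ennreal (slice_length w) \<le> ennreal 2" by simp
  then show ?thesis by (subst (asm) ennreal_le_iff) auto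
qed

lemma slice_length_eq_0: "norm w \<noteq> 1 \<Longrightarrow> slice_length w = 0"
proof -
  assume "norm w \<noteq> 1"
  then have "{t. (t, w) \<in> T} = {}" using T_unit by auto
  then show ?thesis by (simp add: slice_length_def)
qed

lemma slice_length_eq: "slice_length w = enn2real (\<integral>\<^sup>+t. indicator T (t, w) \<partial>lborel)"
proof -
  have "(\<integral>\<^sup>+t. indicator T (t, w) \<partial>lborel) = (\<integral>\<^sup>+t. indicator {t. (t, w) \<in> T} t \<partial>lborel)"
    by (intro nn_integral_cong) (simp add: indicator_def)
  also have "\<dots> = ennreal (slice_length w)" by (simp add: emeasure_slice)
  finally show ?thesis by simp
qed

lemma measurable_slice_length [measurable]: "slice_length \<in> borel_measurable borel"
  unfolding slice_length_eq[abs_def] by measurable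

lemma nn_integral_strip:
  assumes w: "norm w = 1"
  shows "(\<integral>\<^sup>+x. strip x w \<partial>lborel) = (\<integral>\<^sup>+t. indicator T (t, w) * xray (indicator E) w t \<partial>lborel)"
proof -
  have ww: "w \<bullet> w = 1" using w by (simp add: dot_square_norm)
  have "(\<integral>\<^sup>+x. strip x w \<partial>lborel) = (\<integral>\<^sup>+t. \<integral>\<^sup>+u. strip (t *\<^sub>R w + u *\<^sub>R rot w) w \<partial>lborel \<partial>lborel)"
    using w by (intro nn_integral_lborel_rot) measurable
  also have "\<dots> = (\<integral>\<^sup>+t. \<integral>\<^sup>+u. indicator T (t, w) *
      (indicator E (t *\<^sub>R w + u *\<^sub>R rot w) * indicator {-1..1} u) \<partial>lborel \<partial>lborel)"
    by (intro nn_integral_cong) (simp add: strip_def inner_add_left ww mult_ac)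
  also have "\<dots> = (\<integral>\<^sup>+t. indicator T (t, w) * xray (indicator E) w t \<partial>lborel)"
    unfolding xray_def by (intro nn_integral_cong nn_integral_cmult) measurable
  finally show ?thesis .
qed

lemma strip_eq_0: "norm w \<noteq> 1 \<Longrightarrow> strip x w = 0"
  using T_unit by (auto simp: strip_def indicator_def)

lemma nn_integral_indicator_T: "(\<integral>\<^sup>+t. indicator T (t, w) * ennreal c \<partial>lborel) = ennreal (slice_length w) * ennreal c"
proof -
  have "(\<integral>\<^sup>+t. indicator T (t, w) * ennreal c \<partial>lborel)
      = (\<integral>\<^sup>+t. indicator {t. (t, w) \<in> T} t * ennreal c \<partial>lborel)"
    by (intro nn_integral_cong) (simp add: indicator_def)
  also have "\<dots> = ennreal (slice_length w) * ennreal c"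
    by (simp add: nn_integral_multc emeasure_slice)
  finally show ?thesis .
qed

lemma nn_integral_strip_ge: "ennreal (slice_length w) * ennreal \<rho> \<le> (\<integral>\<^sup>+x. strip x w \<partial>lborel)"
proof (cases "norm w = 1")
  case True
  show ?thesis unfolding nn_integral_strip[OF True] nn_integral_indicator_T[symmetric]
    using T_lower by (intro nn_integral_mono) (auto simp: indicator_def)
qed (simp add: slice_length_eq_0)

lemma nn_integral_strip_le: "(\<integral>\<^sup>+x. strip x w \<partial>lborel) \<le> ennreal (slice_length w) * ennreal (2 * \<rho>)"
proof (cases "norm w = 1")
  case True
  show ?thesis unfolding nn_integral_strip[OF True] nn_integral_indicator_T[symmetric]
    using T_upper by (intro nn_integral_mono) (auto simp: indicator_def)
qed (simp add: strip_eq_0)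

text \<open>The strip lies inside \<open>E\<close>. This is the elementary one of the two bounds on
  slice lengths.\<close>

lemma slice_length_times_le: "ennreal (slice_length w) * ennreal \<rho> \<le> emeasure lborel E"
proof -
  note nn_integral_strip_ge
  also have "(\<integral>\<^sup>+x. strip x w \<partial>lborel) \<le> (\<integral>\<^sup>+x. indicator E x \<partial>lborel)"
    by (intro nn_integral_mono) (auto simp: strip_def indicator_def)
  also have "\<dots> = emeasure lborel E" by simp
  finally show ?thesis .
qed

definition overlap :: "real^2 \<Rightarrow> real^2 \<Rightarrow> ennreal" where
  "overlap w w' = (\<integral>\<^sup>+x. strip x w * strip x w' \<partial>lborel)"

lemma measurable_overlap [measurable (raw)]:
  assumes [measurable]: "f \<in> borel_measurable M" "g \<in> borel_measurable M"
  shows "(\<lambda>x. overlap (f x) (g x)) \<in> borel_measurable M"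
  unfolding overlap_def by measurable

lemma overlap_commute: "overlap w w' = overlap w' w"
  by (simp add: overlap_def mult.commute)

text \<open>Dropping the strip of \<open>w\<close> leaves the strip of \<open>w'\<close>, of measure
  at most 2 \<rho> times its slice length. Dropping \<open>E\<close> instead leaves the intersection
  of two families of parallel lines, governed by the sine of the angle. The kernel merges the two
  bounds.\<close>

lemma overlap_le:
  assumes "0 < slice_length w"
  shows "overlap w w' \<le> ennreal (slice_length w') *
    (dyadic_kernel (slice_length w) (2 * \<rho>) \<bar>rot w \<bullet> w'\<bar> * indicator unit_circle w')"
proof (cases "norm w' = 1")
  case True
  have w: "norm w = 1" using assms slice_length_eq_0[of w] by auto
  have "overlap w w' \<le> ennreal (slice_length w') *
    dyadic_kernel (slice_length w) (2 * \<rho>) \<bar>rot w \<bullet> w'\<bar>"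
  proof (rule le_dyadic_kernel)
    have "overlap w w' \<le> (\<integral>\<^sup>+x. strip x w' \<partial>lborel)"
      unfolding overlap_def by (intro nn_integral_mono) (auto simp: strip_def indicator_def)
    also note nn_integral_strip_le
    finally show "overlap w w' \<le> ennreal (2 * \<rho> * slice_length w')"
      using rho by (simp add: ennreal_mult' mult.commute)
    have "overlap w w' \<le> (\<integral>\<^sup>+x. indicator {x. x \<bullet> w \<in> {t. (t, w) \<in> T} \<and> x \<bullet> w' \<in> {t. (t, w') \<in> T}} x \<partial>lborel)"
      unfolding overlap_def by (intro nn_integral_mono) (auto simp: strip_def indicator_def)
    also have "\<dots> = emeasure lborel {x. x \<bullet> w \<in> {t. (t, w) \<in> T} \<and> x \<bullet> w' \<in> {t. (t, w') \<in> T}}"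
      by (intro nn_integral_indicator) simp
    finally have "ennreal \<bar>rot w \<bullet> w'\<bar> * overlap w w' \<le> ennreal \<bar>rot w \<bullet> w'\<bar> * \<dots>"
      by (intro mult_left_mono) auto
    also have "\<dots> \<le> emeasure lborel {t. (t, w) \<in> T} * emeasure lborel {t. (t, w') \<in> T}"
      by (intro emeasure_strips_Int_le w) auto
    finally show "ennreal \<bar>rot w \<bullet> w'\<bar> * overlap w w' \<le> ennreal (slice_length w * slice_length w')"
      by (simp add: emeasure_slice ennreal_mult)
  qed (use assms rho in auto)
  with True show ?thesis by simp
qed (simp add: overlap_def strip_eq_0)

text \<open>The weights \<open>a(w)\<^sup>-\<^sup>\<alpha>\<close> make the integral of the majorant over \<open>w'\<close> proportional to
  \<open>a(w)\<^sup>1\<^sup>-\<^sup>\<alpha>\<close>, so that the moment of \<open>a\<close> reappears on the right-hand side.\<close>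
definition majorant :: "real^2 \<Rightarrow> real^2 \<Rightarrow> ennreal" where
  "majorant w w' = ennreal (slice_length w powr (1 - 2 * \<alpha>)) *
    (dyadic_kernel (slice_length w) (2 * \<rho>) \<bar>rot w \<bullet> w'\<bar> * indicator unit_circle w')"

lemma measurable_majorant [measurable (raw)]:
  assumes [measurable]: "f \<in> borel_measurable M" "g \<in> borel_measurable M"
  shows "(\<lambda>x. majorant (f x) (g x)) \<in> borel_measurable M"
proof -
  have [measurable]: "unit_circle \<in> sets (borel :: (real^2) measure)" by simp
  show ?thesis unfolding majorant_def by measurable
qed

text \<open>With a for \<open>slice_length\<close>, the weights and the factor a(w') from
  \<open>overlap_le\<close> combine to a(w)^(-\<alpha>) a(w')^(1-\<alpha>). As 1 - \<alpha> > 0,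
  passing to the longer slice gives a(w)^(1-2\<alpha>), which no longer involves a(w').\<close>

lemma weighted_overlap_le_majorant:
  assumes le: "slice_length w' \<le> slice_length w"
  shows "ennreal (slice_length w powr - \<alpha>) * ennreal (slice_length w' powr - \<alpha>) * overlap w w'
    \<le> majorant w w'"
proof (cases "slice_length w = 0 \<or> slice_length w' = 0")
  \<comment> \<open>By convention \<open>0 powr - \<alpha>\<close> is 0, so directions with a null
    slice carry no weight.\<close>
  case True
  then show ?thesis by auto
next
  case False
  let ?K = "dyadic_kernel (slice_length w) (2 * \<rho>) \<bar>rot w \<bullet> w'\<bar> * indicator unit_circle w'"
  have pos: "0 < slice_length w" "0 < slice_length w'"
    using False slice_length_nonneg[of w] slice_length_nonneg[of w'] by linarith+
  have "ennreal (slice_length w powr - \<alpha>) * ennreal (slice_length w' powr - \<alpha>) * overlap w w'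
     \<le> ennreal (slice_length w powr - \<alpha>) * ennreal (slice_length w' powr - \<alpha>) *
        (ennreal (slice_length w') * ?K)"
    by (intro mult_left_mono overlap_le pos) auto
  also have "\<dots> = ennreal (slice_length w powr - \<alpha> * (slice_length w' powr - \<alpha> * slice_length w')) * ?K"
    by (simp add: ennreal_mult mult.assoc)
  also have "\<dots> \<le> majorant w w'"
    unfolding majorant_def
  proof (intro mult_right_mono ennreal_leI)
    have "slice_length w' powr - \<alpha> * slice_length w' = slice_length w' powr (1 - \<alpha>)"
      using pos by (simp add: powr_diff powr_minus field_simps)
    also have "\<dots> \<le> slice_length w powr (1 - \<alpha>)"
      using le alpha by (intro powr_mono2) auto
    finally have "slice_length w powr - \<alpha> * (slice_length w' powr - \<alpha> * slice_length w')
       \<le> slice_length w powr - \<alpha> * slice_length w powr (1 - \<alpha>)"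
      by (intro mult_left_mono) auto
    also have "\<dots> = slice_length w powr (1 - 2 * \<alpha>)"
      by (simp add: algebra_simps flip: powr_add)
    finally show "slice_length w powr - \<alpha> * (slice_length w' powr - \<alpha> * slice_length w')
       \<le> slice_length w powr (1 - 2 * \<alpha>)" .
  qed auto
  finally show ?thesis .
qed

definition moment :: ennreal where
  "moment = (\<integral>\<^sup>+w. ennreal (slice_length w powr (1 - \<alpha>)) \<partial>\<nu>)"

text \<open>The kernel integral with M = 2\<rho> and b = a(w) yields, up to
  \<open>kernel_const\<close>, a(w)^(1-2\<alpha>) 2\<rho> (a(w)/(2\<rho>))^\<alpha> =
  (2\<rho>)^(1-\<alpha>) a(w)^(1-\<alpha>).\<close>

lemma nn_integral_majorant_le:
  "(\<integral>\<^sup>+w. \<integral>\<^sup>+w'. majorant w w' \<partial>\<nu> \<partial>\<nu>) \<le> ennreal (kernel_const * (2 * \<rho>) powr (1 - \<alpha>)) * moment"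
proof -
  have [measurable]: "unit_circle \<in> sets (borel :: (real^2) measure)" by simp
  have "(\<integral>\<^sup>+w'. majorant w w' \<partial>\<nu>)
     \<le> ennreal (kernel_const * (2 * \<rho>) powr (1 - \<alpha>)) * ennreal (slice_length w powr (1 - \<alpha>))" for w
  proof (cases "slice_length w = 0")
    case False
    then have pos: "0 < slice_length w" using slice_length_nonneg[of w] by linarith
    have w: "norm w = 1" using False slice_length_eq_0[of w] by auto
    have "(\<integral>\<^sup>+w'. majorant w w' \<partial>\<nu>) = ennreal (slice_length w powr (1 - 2 * \<alpha>)) *
       (\<integral>\<^sup>+w'. dyadic_kernel (slice_length w) (2 * \<rho>) \<bar>rot w \<bullet> w'\<bar> * indicator unit_circle w' \<partial>\<nu>)"
      unfolding majorant_def by (intro nn_integral_cmult) measurable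
    also have "\<dots> \<le> ennreal (slice_length w powr (1 - 2 * \<alpha>)) *
        ennreal (kernel_const * (2 * \<rho>) * (slice_length w / (2 * \<rho>)) powr \<alpha>)"
      using pos rho by (intro mult_left_mono nn_integral_dyadic_kernel_le w) auto
    also have "\<dots> = ennreal (slice_length w powr (1 - 2 * \<alpha>) *
        (kernel_const * (2 * \<rho>) * (slice_length w / (2 * \<rho>)) powr \<alpha>))"
      using rho kernel_const_nonneg by (intro ennreal_mult[symmetric]) auto
    also have "slice_length w powr (1 - 2 * \<alpha>) *
        (kernel_const * (2 * \<rho>) * (slice_length w / (2 * \<rho>)) powr \<alpha>)
      = kernel_const * (2 * \<rho>) powr (1 - \<alpha>) * slice_length w powr (1 - \<alpha>)"
    proof -
      have "(slice_length w / (2 * \<rho>)) powr \<alpha> = slice_length w powr \<alpha> / (2 * \<rho>) powr \<alpha>" by (rule powr_divide)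
      moreover have "(2 * \<rho>) powr (1 - \<alpha>) = (2 * \<rho>) / (2 * \<rho>) powr \<alpha>"
        using rho by (subst powr_diff) simp_all
      moreover have "slice_length w powr (1 - \<alpha>) = slice_length w powr (1 - 2 * \<alpha>) * slice_length w powr \<alpha>"
        by (simp flip: powr_add)
      ultimately show ?thesis by simp
    qed
    finally show ?thesis using kernel_const_nonneg by (simp add: ennreal_mult)
  qed (simp add: majorant_def)
  then have "(\<integral>\<^sup>+w. \<integral>\<^sup>+w'. majorant w w' \<partial>\<nu> \<partial>\<nu>) \<le> (\<integral>\<^sup>+w. ennreal (kernel_const * (2 * \<rho>) powr (1 - \<alpha>)) *
      ennreal (slice_length w powr (1 - \<alpha>)) \<partial>\<nu>)"
    by (intro nn_integral_mono) auto
  also have "\<dots> = ennreal (kernel_const * (2 * \<rho>) powr (1 - \<alpha>)) * moment"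
    unfolding moment_def by (intro nn_integral_cmult) measurable
  finally show ?thesis .
qed

text \<open>Finiteness is what permits cancelling a factor \<open>moment\<close> in
  \<open>moment_le\<close>.\<close>

lemma moment_finite: "moment < \<infinity>"
proof -
  have "moment \<le> (\<integral>\<^sup>+w. ennreal (2 powr (1 - \<alpha>)) \<partial>\<nu>)"
    unfolding moment_def
    using alpha slice_length_le by (intro nn_integral_mono ennreal_leI powr_mono2) auto
  also have "\<dots> < \<infinity>"
    using emeasure_finite[of UNIV] by (auto simp: ennreal_mult_eq_top_iff less_top[symmetric])
  finally show ?thesis .
qed

section \<open>Cauchy--Schwarz for the weighted superposition of strips\<close>

definition density_fun :: "real^2 \<Rightarrow> ennreal" where
  "density_fun x = (\<integral>\<^sup>+w. ennreal (slice_length w powr - \<alpha>) * strip x w \<partial>\<nu>)"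

lemma measurable_density_fun [measurable]: "density_fun \<in> borel_measurable borel"
  unfolding density_fun_def[abs_def] by measurable

text \<open>By Fubini, each direction contributes at least a^(-\<alpha>) a \<rho> = \<rho>
  a^(1-\<alpha>).\<close>

lemma moment_le_nn_integral_density_fun: "ennreal \<rho> * moment \<le> (\<integral>\<^sup>+x. density_fun x \<partial>lborel)"
proof -
  interpret lborel_nu: pair_sigma_finite lborel \<nu> ..
  have "ennreal \<rho> * moment = (\<integral>\<^sup>+w. ennreal \<rho> * ennreal (slice_length w powr (1 - \<alpha>)) \<partial>\<nu>)"
    unfolding moment_def by (intro nn_integral_cmult[symmetric]) measurable
  also have "\<dots> = (\<integral>\<^sup>+w. ennreal (slice_length w powr - \<alpha>) * (ennreal (slice_length w) * ennreal \<rho>) \<partial>\<nu>)"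
  proof (intro nn_integral_cong)
    fix w
    have "slice_length w powr (1 - \<alpha>) = slice_length w powr - \<alpha> * slice_length w"
      using powr_add[of "slice_length w" "- \<alpha>" 1] by (simp add: add.commute)
    then show "ennreal \<rho> * ennreal (slice_length w powr (1 - \<alpha>))
       = ennreal (slice_length w powr - \<alpha>) * (ennreal (slice_length w) * ennreal \<rho>)"
      by (simp add: ennreal_mult mult_ac)
  qed
  also have "\<dots> \<le> (\<integral>\<^sup>+w. ennreal (slice_length w powr - \<alpha>) * (\<integral>\<^sup>+x. strip x w \<partial>lborel) \<partial>\<nu>)"
    by (intro nn_integral_mono mult_left_mono nn_integral_strip_ge) auto
  also have "\<dots> = (\<integral>\<^sup>+w. \<integral>\<^sup>+x. ennreal (slice_length w powr - \<alpha>) * strip x w \<partial>lborel \<partial>\<nu>)"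
    by (intro nn_integral_cong nn_integral_cmult[symmetric]) measurable
  also have "\<dots> = (\<integral>\<^sup>+x. density_fun x \<partial>lborel)"
    unfolding density_fun_def by (intro lborel_nu.Fubini') measurable
  finally show ?thesis .
qed

text \<open>Expanding the square produces the weighted overlaps of all pairs of directions. The
  majorant controls a pair when its first argument has the longer slice, so adding both orders
  covers every pair; by symmetry this costs a factor 2.\<close>

lemma nn_integral_density_fun_sq_le:
  "(\<integral>\<^sup>+x. (density_fun x)\<^sup>2 \<partial>lborel) \<le> ennreal (2 * kernel_const * (2 * \<rho>) powr (1 - \<alpha>)) * moment"
proof -
  interpret lborel_nu: pair_sigma_finite lborel \<nu> ..
  interpret nu_nu: pair_sigma_finite \<nu> \<nu> ..
  let ?h = "\<lambda>w. ennreal (slice_length w powr - \<alpha>)"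
  have "(density_fun x)\<^sup>2 = (\<integral>\<^sup>+w. \<integral>\<^sup>+w'. ?h w * ?h w' * (strip x w * strip x w') \<partial>\<nu> \<partial>\<nu>)" for x
  proof -
    have "(density_fun x)\<^sup>2 = (\<integral>\<^sup>+w. ?h w * strip x w * density_fun x \<partial>\<nu>)"
      by (subst nn_integral_multc) (simp_all add: density_fun_def power2_eq_square)
    also have "\<dots> = (\<integral>\<^sup>+w. \<integral>\<^sup>+w'. ?h w * strip x w * (?h w' * strip x w') \<partial>\<nu> \<partial>\<nu>)"
      unfolding density_fun_def by (intro nn_integral_cong nn_integral_cmult[symmetric]) measurable
    finally show ?thesis by (simp add: mult_ac)
  qed
  then have "(\<integral>\<^sup>+x. (density_fun x)\<^sup>2 \<partial>lborel)
     = (\<integral>\<^sup>+x. \<integral>\<^sup>+w. \<integral>\<^sup>+w'. ?h w * ?h w' * (strip x w * strip x w') \<partial>\<nu> \<partial>\<nu> \<partial>lborel)"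
    by simp
  also have "\<dots> = (\<integral>\<^sup>+w. \<integral>\<^sup>+x. \<integral>\<^sup>+w'. ?h w * ?h w' * (strip x w * strip x w') \<partial>\<nu> \<partial>lborel \<partial>\<nu>)"
    by (intro lborel_nu.Fubini'[symmetric]) measurable
  also have "\<dots> = (\<integral>\<^sup>+w. \<integral>\<^sup>+w'. \<integral>\<^sup>+x. ?h w * ?h w' * (strip x w * strip x w') \<partial>lborel \<partial>\<nu> \<partial>\<nu>)"
    by (intro nn_integral_cong lborel_nu.Fubini'[symmetric]) measurable
  also have "\<dots> = (\<integral>\<^sup>+w. \<integral>\<^sup>+w'. ?h w * ?h w' * overlap w w' \<partial>\<nu> \<partial>\<nu>)"
    unfolding overlap_def by (intro nn_integral_cong nn_integral_cmult) measurable
  also have "\<dots> \<le> (\<integral>\<^sup>+w. \<integral>\<^sup>+w'. majorant w w' + majorant w' w \<partial>\<nu> \<partial>\<nu>)"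
  proof (intro nn_integral_mono)
    fix w w'
    show "?h w * ?h w' * overlap w w' \<le> majorant w w' + majorant w' w"
    proof (cases "slice_length w' \<le> slice_length w")
      case True
      from weighted_overlap_le_majorant[OF this] show ?thesis by (simp add: add_increasing2)
    next
      case False
      then have "?h w' * ?h w * overlap w' w \<le> majorant w' w"
        by (intro weighted_overlap_le_majorant) simp
      then show ?thesis by (simp add: add_increasing mult.commute overlap_commute)
    qed
  qed
  also have "\<dots> = (\<integral>\<^sup>+w. \<integral>\<^sup>+w'. majorant w w' \<partial>\<nu> \<partial>\<nu>) + (\<integral>\<^sup>+w. \<integral>\<^sup>+w'. majorant w' w \<partial>\<nu> \<partial>\<nu>)"
    by (simp add: nn_integral_add)
  also have "(\<integral>\<^sup>+w. \<integral>\<^sup>+w'. majorant w' w \<partial>\<nu> \<partial>\<nu>) = (\<integral>\<^sup>+w. \<integral>\<^sup>+w'. majorant w w' \<partial>\<nu> \<partial>\<nu>)"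
    by (intro nu_nu.Fubini') measurable
  also have "(\<integral>\<^sup>+w. \<integral>\<^sup>+w'. majorant w w' \<partial>\<nu> \<partial>\<nu>) + (\<integral>\<^sup>+w. \<integral>\<^sup>+w'. majorant w w' \<partial>\<nu> \<partial>\<nu>)
     \<le> ennreal (kernel_const * (2 * \<rho>) powr (1 - \<alpha>)) * moment + ennreal (kernel_const * (2 * \<rho>) powr (1 - \<alpha>)) * moment"
    by (intro add_mono nn_integral_majorant_le)
  also have "\<dots> = ennreal (2 * kernel_const * (2 * \<rho>) powr (1 - \<alpha>)) * moment"
    using kernel_const_nonneg by (simp add: distrib_right[symmetric] flip: ennreal_plus)
  finally show ?thesis .
qed

text \<open>With I = \<open>moment\<close> and K = \<open>kernel_const\<close>, the preceding bounds
  and Cauchy--Schwarz give (\<rho> I)^2 \<le> |E| 2 K (2\<rho>)^(1-\<alpha>) I. Cancelling I and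
  using 2^(1-\<alpha>) \<le> 2 yields the constant 4.\<close>

lemma moment_le:
  assumes fin: "emeasure lborel E < \<infinity>"
  shows "moment \<le> ennreal (4 * kernel_const * \<rho> powr (- 1 - \<alpha>)) * emeasure lborel E"
proof -
  obtain i where i: "moment = ennreal i" "0 \<le> i" using moment_finite by (cases moment) auto
  obtain m where m: "emeasure lborel E = ennreal m" "0 \<le> m" using fin by (cases "emeasure lborel E") auto
  have "(ennreal \<rho> * moment)\<^sup>2 \<le> (\<integral>\<^sup>+x. density_fun x \<partial>lborel)\<^sup>2"
    by (intro power_mono moment_le_nn_integral_density_fun) auto
  \<comment> \<open>Every strip lies in \<open>E\<close>, so the superposition vanishes outside it;
    the inserted indicator is the source of the factor |E|.\<close>
  also have "(\<integral>\<^sup>+x. density_fun x \<partial>lborel) = (\<integral>\<^sup>+x. indicator E x * density_fun x \<partial>lborel)"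
    by (intro nn_integral_cong) (auto simp: density_fun_def strip_def indicator_def)
  also have "\<dots>\<^sup>2 \<le> (\<integral>\<^sup>+x. (indicator E x)\<^sup>2 \<partial>lborel) * (\<integral>\<^sup>+x. (density_fun x)\<^sup>2 \<partial>lborel)"
    by (intro Cauchy_Schwarz_nn_integral) auto
  also have "(\<integral>\<^sup>+x. (indicator E x)\<^sup>2 \<partial>lborel) = (\<integral>\<^sup>+x. indicator E x \<partial>lborel)"
    by (intro nn_integral_cong) (simp add: indicator_def)
  also have "\<dots> = ennreal m" by (simp add: m)
  also have "ennreal m * (\<integral>\<^sup>+x. (density_fun x)\<^sup>2 \<partial>lborel)
      \<le> ennreal m * (ennreal (2 * kernel_const * (2 * \<rho>) powr (1 - \<alpha>)) * moment)"
    by (intro mult_left_mono nn_integral_density_fun_sq_le) auto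
  also have "(ennreal \<rho> * moment)\<^sup>2 = ennreal ((\<rho> * i)\<^sup>2)"
    using i rho by (simp add: ennreal_power flip: ennreal_mult)
  finally have "ennreal ((\<rho> * i)\<^sup>2) \<le> ennreal (m * (2 * kernel_const * (2 * \<rho>) powr (1 - \<alpha>) * i))"
    using i m kernel_const_nonneg by (simp flip: ennreal_mult)
  then have "(\<rho> * i)\<^sup>2 \<le> m * (2 * kernel_const * (2 * \<rho>) powr (1 - \<alpha>) * i)"
    using i m kernel_const_nonneg by (subst (asm) ennreal_le_iff) auto
  then have le: "i * (i * \<rho>\<^sup>2) \<le> i * (m * 2 * kernel_const * (2 * \<rho>) powr (1 - \<alpha>))"
    by (simp add: power2_eq_square mult_ac)
  have "i \<le> 4 * kernel_const * \<rho> powr (- 1 - \<alpha>) * m"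
  proof (cases "i = 0")
    case True
    then show ?thesis using m kernel_const_nonneg by simp
  next
    case False
    then have "i * \<rho>\<^sup>2 \<le> m * 2 * kernel_const * (2 * \<rho>) powr (1 - \<alpha>)"
      using le i by simp
    also have "(2 * \<rho>) powr (1 - \<alpha>) = 2 powr (1 - \<alpha>) * \<rho> powr (1 - \<alpha>)" by (rule powr_mult)
    also have "m * 2 * kernel_const * (2 powr (1 - \<alpha>) * \<rho> powr (1 - \<alpha>))
       \<le> m * 2 * kernel_const * (2 * \<rho> powr (1 - \<alpha>))"
      using m kernel_const_nonneg alpha powr_mono[of "1 - \<alpha>" 1 2]
      by (intro mult_left_mono mult_right_mono) auto
    also have "\<rho> powr (1 - \<alpha>) = \<rho> powr (- 1 - \<alpha>) * \<rho>\<^sup>2"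
      using rho by (simp flip: powr_add powr_numeral)
    finally have "i * \<rho>\<^sup>2 \<le> (4 * kernel_const * \<rho> powr (- 1 - \<alpha>) * m) * \<rho>\<^sup>2"
      by (simp add: mult_ac)
    then show ?thesis using rho by simp
  qed
  then show ?thesis using i m kernel_const_nonneg
    by (simp add: ennreal_leI flip: ennreal_mult)
qed

end

end

section \<open>Dyadic decomposition\<close>

abbreviation unit_interval :: "real measure" where
  "unit_interval \<equiv> restrict_space lborel {-1..1}"

text \<open>The levels start at height 1: the part where \<open>N\<close> is at most 1 contributes a
  bounded amount on segments of length 2 and is split off.\<close>

definition level_set :: "(real^2 \<Rightarrow> real) \<Rightarrow> nat \<Rightarrow> (real^2) set" where
  "level_set N k = {x. 2 ^ k < N x \<and> N x \<le> 2 ^ Suc k}"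

text \<open>Half-open ranges make the slabs for fixed \<open>k\<close> disjoint. Indices j \<ge> 0
  suffice, since the X-ray transform of an indicator is at most 2.\<close>

definition slab :: "(real^2 \<Rightarrow> real) \<Rightarrow> nat \<Rightarrow> nat \<Rightarrow> (real \<times> (real^2)) set" where
  "slab N k j = {(t, w). norm w = 1 \<and> \<bar>t\<bar> \<le> 1 \<and>
     ennreal ((1 / 2) ^ j) < xray (indicator (level_set N k)) w t \<and>
     xray (indicator (level_set N k)) w t \<le> ennreal (2 * (1 / 2) ^ j)}"

lemma sets_level_set [measurable]:
  assumes [measurable]: "N \<in> borel_measurable borel"
  shows "level_set N k \<in> sets borel"
  unfolding level_set_def by measurable

lemma sets_slab [measurable]:
  assumes [measurable]: "N \<in> borel_measurable borel"
  shows "slab N k j \<in> sets (borel \<Otimes>\<^sub>M borel)"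
proof -
  have "{p \<in> space (borel \<Otimes>\<^sub>M borel). norm (snd p) = 1 \<and> \<bar>fst p\<bar> \<le> 1 \<and>
     ennreal ((1 / 2) ^ j) < xray (indicator (level_set N k)) (snd p) (fst p) \<and>
     xray (indicator (level_set N k)) (snd p) (fst p) \<le> ennreal (2 * (1 / 2) ^ j)}
    \<in> sets (borel \<Otimes>\<^sub>M borel)" by measurable
  then show ?thesis by (simp add: slab_def split_beta' space_pair_measure)
qed

lemma le_suminf_level_set:
  "ennreal (N x) \<le> 1 + (\<Sum>k. ennreal (2 ^ Suc k) * indicator (level_set N k) x)"
proof (cases "N x \<le> 1")
  case True
  then have "ennreal (N x) \<le> 1" by (simp add: ennreal_le_1)
  then show ?thesis by (simp add: add_increasing2)
next
  case False
  obtain n where n: "N x < 2 ^ n" using real_arch_pow[of 2 "N x"] by auto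
  define k where "k = (LEAST k. N x \<le> 2 ^ Suc k)"
  have "N x \<le> 2 ^ Suc n" using n by (simp add: order.strict_implies_order order_less_le_trans)
  then have k: "N x \<le> 2 ^ Suc k" unfolding k_def by (rule LeastI)
  have "2 ^ k < N x"
  proof (cases k)
    case 0
    then show ?thesis using False by simp
  next
    case (Suc m)
    then show ?thesis using not_less_Least[of m "\<lambda>k. N x \<le> 2 ^ Suc k"] by (simp add: k_def)
  qed
  with k have "ennreal (N x) \<le> ennreal (2 ^ Suc k) * indicator (level_set N k) x"
    by (auto simp: level_set_def intro!: ennreal_leI)
  also have "\<dots> \<le> (\<Sum>k. ennreal (2 ^ Suc k) * indicator (level_set N k) x)"
    by (rule le_suminf)
  finally show ?thesis by (simp add: add_increasing)
qed

lemma xray_le_2: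
  assumes "\<And>x. g x \<le> 1"
  shows "xray g w t \<le> 2"
proof -
  have "xray g w t \<le> (\<integral>\<^sup>+u. indicator {-1..1::real} u \<partial>lborel)"
    unfolding xray_def by (intro nn_integral_mono) (use assms in \<open>auto simp: indicator_def\<close>)
  then show ?thesis by simp
qed

lemma xray_level_set_le:
  assumes w: "norm w = 1" and t: "\<bar>t\<bar> \<le> 1"
  shows "xray (indicator (level_set N k)) w t
    \<le> (\<Sum>j. ennreal (2 * (1 / 2) ^ j) * indicator (slab N k j) (t, w))"
proof -
  let ?X = "xray (indicator (level_set N k)) w t"
  have X2: "?X \<le> 2" by (intro xray_le_2) (simp add: indicator_def)
  then obtain x where x: "?X = ennreal x" "0 \<le> x" by (cases ?X) (auto simp: top_unique)
  then have "ennreal x \<le> ennreal 2" using X2 by simp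
  then have x2: "x \<le> 2" by (subst (asm) ennreal_le_iff) auto
  show ?thesis
  proof (cases "x = 0")
    case False
    then obtain n where n: "(1 / 2) ^ n < x" using x real_arch_pow_inv[of x "1 / 2"] by auto
    define j where "j = (LEAST j. (1 / 2) ^ j < x)"
    have j: "(1 / 2) ^ j < x" unfolding j_def by (rule LeastI[of _ n]) (rule n)
    have j2: "x \<le> 2 * (1 / 2) ^ j"
    proof (cases j)
      case 0
      then show ?thesis using x2 by simp
    next
      case (Suc m)
      then show ?thesis using not_less_Least[of m "\<lambda>j. (1 / 2) ^ j < x"] by (simp add: j_def)
    qed
    have "(t, w) \<in> slab N k j"
      using j j2 w t x by (simp add: slab_def ennreal_less_iff ennreal_leI)
    then have "?X \<le> ennreal (2 * (1 / 2) ^ j) * indicator (slab N k j) (t, w)"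
      using j2 x by (simp add: ennreal_leI)
    also have "\<dots> \<le> (\<Sum>j. ennreal (2 * (1 / 2) ^ j) * indicator (slab N k j) (t, w))"
      by (rule le_suminf)
    finally show ?thesis .
  qed (simp add: x)
qed

text \<open>The summand 2 is the integral of the constant 1 over a segment. A level has height at
  most 2^(k+1) and a slab X-ray value at most 2 2^(-j), hence the coefficients.\<close>

lemma xray_le_slabs:
  assumes [measurable]: "N \<in> borel_measurable borel" and w: "norm w = 1" and t: "\<bar>t\<bar> \<le> 1"
  shows "xray (\<lambda>x. ennreal (N x)) w t
    \<le> 2 + (\<Sum>k. \<Sum>j. ennreal (4 * 2 ^ k * (1 / 2) ^ j) * indicator (slab N k j) (t, w))"
proof -
  let ?x = "\<lambda>u. t *\<^sub>R w + u *\<^sub>R rot w"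
  have "xray (\<lambda>x. ennreal (N x)) w t \<le> (\<integral>\<^sup>+u. indicator {-1..1} u +
      (\<Sum>k. ennreal (2 ^ Suc k) * (indicator (level_set N k) (?x u) * indicator {-1..1} u)) \<partial>lborel)"
    unfolding xray_def
  proof (intro nn_integral_mono)
    fix u
    show "ennreal (N (?x u)) * indicator {-1..1} u \<le> indicator {-1..1} u +
      (\<Sum>k. ennreal (2 ^ Suc k) * (indicator (level_set N k) (?x u) * indicator {-1..1} u))"
      using le_suminf_level_set[of N "?x u"] by (simp add: indicator_def)
  qed
  also have "\<dots> = 2 + (\<integral>\<^sup>+u. (\<Sum>k. ennreal (2 ^ Suc k) *
      (indicator (level_set N k) (?x u) * indicator {-1..1} u)) \<partial>lborel)"
    by (subst nn_integral_add) simp_all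
  also have "(\<integral>\<^sup>+u. (\<Sum>k. ennreal (2 ^ Suc k) *
      (indicator (level_set N k) (?x u) * indicator {-1..1} u)) \<partial>lborel)
    = (\<Sum>k. \<integral>\<^sup>+u. ennreal (2 ^ Suc k) *
      (indicator (level_set N k) (?x u) * indicator {-1..1} u) \<partial>lborel)"
    by (intro nn_integral_suminf) measurable
  also have "\<dots> = (\<Sum>k. ennreal (2 ^ Suc k) * xray (indicator (level_set N k)) w t)"
    unfolding xray_def by (intro suminf_cong nn_integral_cmult) measurable
  also have "\<dots> \<le> (\<Sum>k. ennreal (2 ^ Suc k) *
      (\<Sum>j. ennreal (2 * (1 / 2) ^ j) * indicator (slab N k j) (t, w)))"
    by (intro suminf_le mult_left_mono xray_level_set_le w t) auto
  also have "\<dots> = (\<Sum>k. \<Sum>j. ennreal (4 * 2 ^ k * (1 / 2) ^ j) * indicator (slab N k j) (t, w))"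
    unfolding ennreal_suminf_cmult[symmetric] mult.assoc[symmetric]
    by (intro suminf_cong arg_cong2[where f="(*)"] refl) (simp add: mult_ac flip: ennreal_mult)
  finally show ?thesis by (simp add: add_left_mono)
qed

lemma suminf_geometric2:
  fixes D x y :: real
  assumes "0 \<le> D" "0 \<le> x" "x < 1" "0 \<le> y" "y < 1"
  shows "(\<Sum>k. \<Sum>j. ennreal (D * x ^ k * y ^ j)) = ennreal (D * (1 / (1 - x)) * (1 / (1 - y)))"
proof -
  have "(\<Sum>j. ennreal (D * x ^ k * y ^ j)) = ennreal (D * x ^ k * (1 / (1 - y)))" for k
    using assms by (intro suminf_ennreal_eq sums_mult geometric_sums) auto
  then have "(\<Sum>k. \<Sum>j. ennreal (D * x ^ k * y ^ j)) = (\<Sum>k. ennreal (D * x ^ k * (1 / (1 - y))))"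
    by simp
  also have "\<dots> = ennreal (D * (1 / (1 - x)) * (1 / (1 - y)))"
    using assms by (intro suminf_ennreal_eq sums_mult sums_mult2 geometric_sums) auto
  finally show ?thesis .
qed

lemma Lp_norm_le_const:
  assumes "0 < r" "\<And>x. x \<in> space M \<Longrightarrow> g x \<le> c"
  shows "Lp_norm (ennreal r) M g \<le> c * ennreal_powr (emeasure M (space M)) (1 / r)"
proof -
  have "Lp_norm (ennreal r) M g \<le> Lp_norm (ennreal r) M (\<lambda>_. c)"
    using assms by (intro Lp_norm_mono)
  also have "\<dots> = c * ennreal_powr (emeasure M (space M)) (1 / r)"
    using assms by (simp add: Lp_norm_ennreal ennreal_powr_mult ennreal_powr_powr)
  finally show ?thesis .
qed

lemma Lp_norm_indicator:
  assumes "0 < r" "A \<in> sets M"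
  shows "Lp_norm (ennreal r) M (indicator A) = ennreal_powr (emeasure M A) (1 / r)"
proof -
  have "(\<integral>\<^sup>+x. ennreal_powr (indicator A x) r \<partial>M) = (\<integral>\<^sup>+x. indicator A x \<partial>M)"
    by (intro nn_integral_cong) (simp add: indicator_def ennreal_powr_def)
  then show ?thesis using assms by (simp add: Lp_norm_ennreal)
qed

text \<open>Minkowski's inequality in t, where a slab of slice length a has norm a^(1/s). The
  summand 4 bounds 2 2^(1/s), the norm of the constant 2.\<close>

lemma Lp_norm_xray_le:
  assumes N [measurable]: "N \<in> borel_measurable borel" and w: "norm w = 1" and s: "1 \<le> s"
  shows "Lp_norm (ennreal s) unit_interval (xray (\<lambda>x. ennreal (N x)) w)
    \<le> 4 + (\<Sum>k. \<Sum>j. ennreal (4 * 2 ^ k * (1 / 2) ^ j) *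
        ennreal (measure lborel {t. (t, w) \<in> slab N k j} powr (1 / s)))"
proof -
  let ?c = "\<lambda>k j. ennreal (4 * 2 ^ k * (1 / 2) ^ j) :: ennreal"
  have m [measurable]: "(\<lambda>t. indicator (slab N k j) (t, w) :: ennreal) \<in> borel_measurable unit_interval" for k j
    by (intro measurable_restrict_space1) measurable
  have "Lp_norm (ennreal s) unit_interval (xray (\<lambda>x. ennreal (N x)) w)
     \<le> Lp_norm (ennreal s) unit_interval (\<lambda>t. 2 + (\<Sum>k. \<Sum>j. ?c k j * indicator (slab N k j) (t, w)))"
    using s by (intro Lp_norm_mono xray_le_slabs N w) (auto simp: space_restrict_space)
  also have "\<dots> \<le> Lp_norm (ennreal s) unit_interval (\<lambda>t. 2) +
      Lp_norm (ennreal s) unit_interval (\<lambda>t. \<Sum>k. \<Sum>j. ?c k j * indicator (slab N k j) (t, w))"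
    using s by (intro Lp_norm_add) measurable
  also have "\<dots> \<le> 4 + (\<Sum>k. \<Sum>j. ?c k j * ennreal (measure lborel {t. (t, w) \<in> slab N k j} powr (1 / s)))"
  proof (intro add_mono)
    have "Lp_norm (ennreal s) unit_interval (\<lambda>t. 2)
       \<le> 2 * ennreal_powr (emeasure unit_interval (space unit_interval)) (1 / s)"
      using s by (intro Lp_norm_le_const) auto
    also have "emeasure unit_interval (space unit_interval) = ennreal 2"
      by (simp add: space_restrict_space emeasure_restrict_space)
    also have "2 * ennreal_powr (ennreal 2) (1 / s) \<le> 2 * ennreal 2"
    proof (intro mult_left_mono)
      have "2 powr (1 / s) \<le> 2 powr (1::real)" using s by (intro powr_mono) auto
      then show "ennreal_powr (ennreal 2) (1 / s) \<le> ennreal 2"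
        by (subst ennreal_powr_ennreal) (simp, rule ennreal_leI, simp)
    qed auto
    finally show "Lp_norm (ennreal s) unit_interval (\<lambda>t. 2) \<le> 4" by simp
    have "Lp_norm (ennreal s) unit_interval (\<lambda>t. \<Sum>k. \<Sum>j. ?c k j * indicator (slab N k j) (t, w))
       \<le> (\<Sum>k. Lp_norm (ennreal s) unit_interval (\<lambda>t. \<Sum>j. ?c k j * indicator (slab N k j) (t, w)))"
      using s by (intro Lp_norm_suminf) measurable
    also have "\<dots> \<le> (\<Sum>k. \<Sum>j. Lp_norm (ennreal s) unit_interval (\<lambda>t. ?c k j * indicator (slab N k j) (t, w)))"
      using s by (intro suminf_le Lp_norm_suminf) measurable
    also have "\<dots> = (\<Sum>k. \<Sum>j. ?c k j * Lp_norm (ennreal s) unit_interval (\<lambda>t. indicator (slab N k j) (t, w)))"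
      using s by (intro suminf_cong Lp_norm_cmult) auto
    also have "\<dots> = (\<Sum>k. \<Sum>j. ?c k j * ennreal (measure lborel {t. (t, w) \<in> slab N k j} powr (1 / s)))"
    proof (intro suminf_cong arg_cong2[where f="(*)"] refl)
      fix k j
      let ?S = "{t. (t, w) \<in> slab N k j}"
      have sub: "?S \<subseteq> {-1..1}" by (auto simp: slab_def abs_le_iff)
      have S [measurable]: "?S \<in> sets lborel" by measurable
      have "Lp_norm (ennreal s) unit_interval (\<lambda>t. indicator (slab N k j) (t, w))
         = Lp_norm (ennreal s) unit_interval (indicator ?S)"
        by (intro arg_cong[where f="Lp_norm (ennreal s) unit_interval"]) (auto simp: indicator_def)
      also have "\<dots> = ennreal_powr (emeasure unit_interval ?S) (1 / s)"
        using s sub S by (intro Lp_norm_indicator) (auto simp: sets_restrict_space_iff)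
      also have "emeasure unit_interval ?S = emeasure lborel ?S"
        using sub by (intro emeasure_restrict_space) auto
      also have "emeasure lborel ?S = ennreal (measure lborel ?S)"
      proof -
        have "emeasure lborel ?S \<le> emeasure lborel {-1..1::real}"
          using sub by (intro emeasure_mono) auto
        also have "\<dots> < \<infinity>" by simp
        finally show ?thesis by (intro emeasure_eq_ennreal_measure) auto
      qed
      finally show "Lp_norm (ennreal s) unit_interval (\<lambda>t. indicator (slab N k j) (t, w))
         = ennreal (measure lborel ?S powr (1 / s))" by simp
    qed
    finally show "Lp_norm (ennreal s) unit_interval (\<lambda>t. \<Sum>k. \<Sum>j. ?c k j * indicator (slab N k j) (t, w))
       \<le> (\<Sum>k. \<Sum>j. ?c k j * ennreal (measure lborel {t. (t, w) \<in> slab N k j} powr (1 / s)))" .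
  qed
  finally show ?thesis .
qed

section \<open>Mixed norm bounds for X-ray transforms\<close>

text \<open>The estimates for a single set, with the level set as \<open>E\<close> and 2^(-j) as
  \<open>\<rho>\<close>.\<close>

lemma (in circle_measure) slab_bounds:
  fixes N :: "real^2 \<Rightarrow> real" and k j :: nat and P :: real
  assumes N [measurable]: "N \<in> borel_measurable borel"
    and E: "emeasure lborel (level_set N k) \<le> ennreal (2 powr (- P * real k))"
  defines "a \<equiv> \<lambda>w. measure lborel {t. (t, w) \<in> slab N k j}"
  shows "a w \<le> 2" "a w \<le> 2 powr (real j - P * real k)"
    "a \<in> borel_measurable borel"
    "(\<integral>\<^sup>+w. ennreal (a w powr (1 - \<alpha>)) \<partial>\<nu>)
      \<le> ennreal (4 * kernel_const * 2 powr ((1 + \<alpha>) * real j - P * real k))"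
proof -
  \<comment> \<open>These are the assumptions on \<open>E\<close>, \<open>T\<close> and
    \<open>\<rho>\<close> in their original order, to be discharged in each fact taken from that
    context.\<close>
  have hyps: "level_set N k \<in> sets borel" "slab N k j \<in> sets (borel \<Otimes>\<^sub>M borel)"
    "0 < (1 / 2 :: real) ^ j"
    "\<And>t w. (t, w) \<in> slab N k j \<Longrightarrow> norm w = 1"
    "\<And>t w. (t, w) \<in> slab N k j \<Longrightarrow> \<bar>t\<bar> \<le> 1"
    "\<And>t w. (t, w) \<in> slab N k j \<Longrightarrow> ennreal ((1 / 2) ^ j) \<le> xray (indicator (level_set N k)) w t"
    "\<And>t w. (t, w) \<in> slab N k j \<Longrightarrow> xray (indicator (level_set N k)) w t \<le> ennreal (2 * (1 / 2) ^ j)"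
    by (measurable; fail | auto simp: slab_def)+
  have half: "(1 / 2 :: real) ^ j = 2 powr (- real j)"
    by (simp add: powr_minus powr_realpow power_one_over inverse_eq_divide)
  have a: "a = slice_length (slab N k j)"
    by (simp add: a_def fun_eq_iff slice_length_def[OF hyps])
  show "a w \<le> 2" unfolding a by (rule slice_length_le[OF hyps])
  show "a \<in> borel_measurable borel" unfolding a by (rule measurable_slice_length[OF hyps])
  have fin: "emeasure lborel (level_set N k) < \<infinity>"
    using E by (rule order_le_less_trans) simp
  have "ennreal (a w) * ennreal ((1 / 2) ^ j) \<le> ennreal (2 powr (- P * real k))"
    unfolding a using slice_length_times_le[OF hyps] E by (rule order_trans)
  then have "a w * 2 powr (- real j) \<le> 2 powr (- P * real k)"
    unfolding half by (subst (asm) ennreal_mult[symmetric]) (simp_all add: a_def)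
  then show "a w \<le> 2 powr (real j - P * real k)"
    by (simp add: powr_diff powr_minus field_simps)
  have "(\<integral>\<^sup>+w. ennreal (a w powr (1 - \<alpha>)) \<partial>\<nu>)
      \<le> ennreal (4 * kernel_const * ((1 / 2) ^ j) powr (- 1 - \<alpha>)) * emeasure lborel (level_set N k)"
    using moment_le[OF hyps fin] by (simp add: a moment_def[OF hyps])
  also have "\<dots> \<le> ennreal (4 * kernel_const * ((1 / 2) ^ j) powr (- 1 - \<alpha>)) * ennreal (2 powr (- P * real k))"
    by (intro mult_left_mono E) auto
  also have "\<dots> = ennreal (4 * kernel_const * (((1 / 2) ^ j) powr (- 1 - \<alpha>) * 2 powr (- P * real k)))"
    using kernel_const_nonneg by (simp add: mult.assoc flip: ennreal_mult)
  also have "((1 / 2) ^ j) powr (- 1 - \<alpha>) * 2 powr (- P * real k) = 2 powr ((1 + \<alpha>) * real j - P * real k)"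
    unfolding half powr_powr powr_add[symmetric] by (simp add: algebra_simps)
  finally show "(\<integral>\<^sup>+w. ennreal (a w powr (1 - \<alpha>)) \<partial>\<nu>)
      \<le> ennreal (4 * kernel_const * 2 powr ((1 + \<alpha>) * real j - P * real k))" .
qed

text \<open>Only the share \<open>W\<close> of the exponent is spent on the bound \<open>b\<close>;
  the remainder uses a \<le> 2. This leaves \<open>W\<close> as a parameter for tuning the
  decay.\<close>

lemma powr_le_interpolate:
  fixes a b z W :: real
  assumes "0 \<le> a" "a \<le> 2" "a \<le> b" "0 \<le> W" "W \<le> z"
  shows "a powr z \<le> 2 powr (z - W) * b powr W"
proof -
  have "a powr z = a powr (z - W) * a powr W" by (simp flip: powr_add)
  also have "\<dots> \<le> 2 powr (z - W) * b powr W"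
    using assms by (intro mult_mono powr_mono2) auto
  finally show ?thesis .
qed

lemma powr_of_nat_mult: "(2::real) powr (c * real n) = (2 powr c) ^ n"
  by (simp add: powr_powr flip: powr_realpow)

context circle_measure
begin

text \<open>Only the elementary bound a \<le> 2^(j-Pk) enters: the (k,j) term is at most a constant
  times 2^((1-PW)k) 2^((W-1)j), summable in both indices. Uniformity in the direction makes this
  usable for q = \<infinity>.\<close>

lemma xray_bound_pointwise:
  assumes s: "1 \<le> s" and W: "0 < W" "W \<le> 1 / s" "W < 1" "1 < P * W"
  shows "\<exists>B\<ge>0. \<forall>N \<in> borel_measurable borel.
    (\<forall>k. emeasure lborel (level_set N k) \<le> ennreal (2 powr (- P * real k))) \<longrightarrow>
    (\<forall>w. norm w = 1 \<longrightarrow> Lp_norm (ennreal s) unit_interval (xray (\<lambda>x. ennreal (N x)) w) \<le> ennreal B)"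
proof -
  define x y where "x = 2 powr (1 - P * W)" and "y = 2 powr (W - 1)"
  have xy: "0 \<le> x" "x < 1" "0 \<le> y" "y < 1"
    using W powr_less_mono[of "1 - P * W" 0 2] powr_less_mono[of "W - 1" 0 2]
    by (auto simp: x_def y_def)
  \<comment> \<open>The 8 is the coefficient 4 times the bound 2 for 2^(1/s-W); the other factors
    are the sums of the two geometric series.\<close>
  define S where "S = 8 * (1 / (1 - x)) * (1 / (1 - y))"
  have "0 \<le> S" using xy by (simp add: S_def)
  show ?thesis
  proof (intro exI[of _ "4 + S"] conjI ballI impI allI)
    fix N :: "real^2 \<Rightarrow> real" and w :: "real^2"
    assume N: "N \<in> borel_measurable borel" and w: "norm w = 1"
      and E: "\<forall>k. emeasure lborel (level_set N k) \<le> ennreal (2 powr (- P * real k))"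
    let ?a = "\<lambda>k j. measure lborel {t. (t, w) \<in> slab N k j}"
    have "4 * 2 ^ k * (1 / 2) ^ j * ?a k j powr (1 / s) \<le> 8 * x ^ k * y ^ j" for k j
    proof -
      have "?a k j powr (1 / s) \<le> 2 powr (1 / s - W) * (2 powr (real j - P * real k)) powr W"
        using slab_bounds(1,2)[OF N E[rule_format]] W by (intro powr_le_interpolate) auto
      also have "\<dots> \<le> 2 * (2 powr (real j - P * real k)) powr W"
      proof (rule mult_right_mono)
        have "1 / s \<le> 1" using s by simp
        with W have "1 / s - W \<le> 1" by linarith
        then show "2 powr (1 / s - W) \<le> (2::real)" using powr_mono[of "1 / s - W" 1 "2::real"] by simp
      qed simp
      finally have "4 * 2 ^ k * (1 / 2) ^ j * ?a k j powr (1 / s)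
         \<le> 4 * 2 ^ k * (1 / 2) ^ j * (2 * (2 powr (real j - P * real k)) powr W)"
        by (intro mult_left_mono) auto
      also have "\<dots> = 8 * (2 powr real k * 2 powr (- real j) * 2 powr ((real j - P * real k) * W))"
        by (simp add: powr_powr powr_minus powr_realpow power_one_over inverse_eq_divide)
      also have "2 powr real k * 2 powr (- real j) * 2 powr ((real j - P * real k) * W)
         = 2 powr ((1 - P * W) * real k) * 2 powr ((W - 1) * real j)"
        unfolding powr_add[symmetric] by (simp add: algebra_simps)
      also have "\<dots> = x ^ k * y ^ j" by (simp add: x_def y_def powr_of_nat_mult)
      finally show ?thesis by (simp add: mult.assoc)
    qed
    then have term_le: "ennreal (4 * 2 ^ k * (1 / 2) ^ j) * ennreal (?a k j powr (1 / s)) \<le> ennreal (8 * x ^ k * y ^ j)" for k j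
      by (simp add: ennreal_leI flip: ennreal_mult)
    have "Lp_norm (ennreal s) unit_interval (xray (\<lambda>x. ennreal (N x)) w)
      \<le> 4 + (\<Sum>k. \<Sum>j. ennreal (4 * 2 ^ k * (1 / 2) ^ j) * ennreal (?a k j powr (1 / s)))"
      using N w s by (rule Lp_norm_xray_le)
    also have "\<dots> \<le> 4 + (\<Sum>k. \<Sum>j. ennreal (8 * x ^ k * y ^ j))"
      by (intro add_left_mono suminf_le term_le) auto
    also have "\<dots> = ennreal (4 + S)"
      using xy \<open>0 \<le> S\<close> by (subst suminf_geometric2) (simp_all add: S_def)
    finally show "Lp_norm (ennreal s) unit_interval (xray (\<lambda>x. ennreal (N x)) w) \<le> ennreal (4 + S)" .
  qed (use \<open>0 \<le> S\<close> in auto)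
qed

text \<open>In the r-th power, a^(r/s) is split into a^(r/s-(1-\<alpha>)) and a^(1-\<alpha>). The
  elementary bound controls the first factor with share W r, the moment estimate the second. After
  taking r-th roots, the ratios in k and j are the \<open>x\<close> and \<open>y\<close> of the
  proof.\<close>

lemma xray_bound_mixed:
  assumes s: "1 \<le> s" and r: "1 \<le> r" and W: "0 \<le> W" "W + (1 - \<alpha>) / r \<le> 1 / s"
    "W + (1 + \<alpha>) / r < 1" "1 < P * (W + 1 / r)"
  shows "\<exists>B\<ge>0. \<forall>N \<in> borel_measurable borel.
    (\<forall>k. emeasure lborel (level_set N k) \<le> ennreal (2 powr (- P * real k))) \<longrightarrow>
    Lp_norm (ennreal r) \<nu> (\<lambda>w. Lp_norm (ennreal s) unit_interval (xray (\<lambda>x. ennreal (N x)) w) *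
      indicator unit_circle w) \<le> ennreal B"
proof -
  define x y where "x = 2 powr (1 - P * (W + 1 / r))" and "y = 2 powr (W + (1 + \<alpha>) / r - 1)"
  have xy: "0 \<le> x" "x < 1" "0 \<le> y" "y < 1"
    using W powr_less_mono[of "1 - P * (W + 1 / r)" 0 2] powr_less_mono[of "W + (1 + \<alpha>) / r - 1" 0 2]
    by (auto simp: x_def y_def)
  \<comment> \<open>\<open>K\<close> is the r-th root of the constant in the moment
    estimate.\<close>
  define K where "K = (4 * kernel_const) powr (1 / r)"
  define S where "S = 8 * K * (1 / (1 - x)) * (1 / (1 - y))"
  have K0: "0 \<le> K" by (simp add: K_def)
  then have S0: "0 \<le> S" using xy by (simp add: S_def)
  \<comment> \<open>\<open>m\<close> is the norm over the directions of the constant 4 from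
    \<open>Lp_norm_xray_le\<close>.\<close>
  define m where "m = 4 * measure \<nu> UNIV powr (1 / r)"
  have m0: "0 \<le> m" by (simp add: m_def)
  show ?thesis
  proof (intro exI[of _ "m + S"] conjI ballI impI)
    fix N :: "real^2 \<Rightarrow> real"
    assume N: "N \<in> borel_measurable borel"
      and E: "\<forall>k. emeasure lborel (level_set N k) \<le> ennreal (2 powr (- P * real k))"
    let ?a = "\<lambda>k j w. measure lborel {t. (t, w) \<in> slab N k j}"
    let ?c = "\<lambda>k j. ennreal (4 * 2 ^ k * (1 / 2) ^ j) :: ennreal"
    note a = slab_bounds[OF N E[rule_format]]
    note a(3) [measurable]
    have norm_a: "Lp_norm (ennreal r) \<nu> (\<lambda>w. ennreal (?a k j w powr (1 / s)))
      \<le> ennreal (2 * K * 2 powr ((real j - P * real k) * W + ((1 + \<alpha>) * real j - P * real k) / r))" for k j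
    proof -
      define b where "b = 2 powr (real j - P * real k)"
      have "(\<integral>\<^sup>+w. ennreal_powr (ennreal (?a k j w powr (1 / s))) r \<partial>\<nu>)
        \<le> (\<integral>\<^sup>+w. ennreal (2 powr r * b powr (W * r)) * ennreal (?a k j w powr (1 - \<alpha>)) \<partial>\<nu>)"
      proof (intro nn_integral_mono)
        fix w
        have "?a k j w powr (r / s) = ?a k j w powr (r / s - (1 - \<alpha>)) * ?a k j w powr (1 - \<alpha>)"
          by (simp flip: powr_add)
        also have "?a k j w powr (r / s - (1 - \<alpha>)) \<le> 2 powr (r / s - (1 - \<alpha>) - W * r) * b powr (W * r)"
        proof (rule powr_le_interpolate)
          have "(W + (1 - \<alpha>) / r) * r \<le> 1 / s * r" using W r by (intro mult_right_mono) auto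
          then show "W * r \<le> r / s - (1 - \<alpha>)" using r by (simp add: distrib_right)
        qed (use a(1,2) W r in \<open>auto simp: b_def\<close>)
        \<comment> \<open>Taking the r-th root later turns this bound into the factor 2 contained in
          the 8 of \<open>S\<close>.\<close>
        also have "2 powr (r / s - (1 - \<alpha>) - W * r) \<le> 2 powr r"
        proof (rule powr_mono)
          have "r / s \<le> r / 1" using s r by (intro divide_left_mono) auto
          moreover have "0 \<le> W * r" using W r by simp
          ultimately show "r / s - (1 - \<alpha>) - W * r \<le> r" using alpha by linarith
        qed simp
        finally have "?a k j w powr (r / s) \<le> 2 powr r * b powr (W * r) * ?a k j w powr (1 - \<alpha>)"
          by (simp add: mult_right_mono)
        then show "ennreal_powr (ennreal (?a k j w powr (1 / s))) r
           \<le> ennreal (2 powr r * b powr (W * r)) * ennreal (?a k j w powr (1 - \<alpha>))"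
          by (simp add: powr_powr ennreal_leI flip: ennreal_mult)
      qed
      also have "\<dots> = ennreal (2 powr r * b powr (W * r)) * (\<integral>\<^sup>+w. ennreal (?a k j w powr (1 - \<alpha>)) \<partial>\<nu>)"
        by (intro nn_integral_cmult) measurable
      also have "\<dots> \<le> ennreal (2 powr r * b powr (W * r)) *
          ennreal (4 * kernel_const * 2 powr ((1 + \<alpha>) * real j - P * real k))"
        by (intro mult_left_mono a(4)) auto
      also have "\<dots> = ennreal (2 powr r * b powr (W * r) *
          (4 * kernel_const * 2 powr ((1 + \<alpha>) * real j - P * real k)))"
        using kernel_const_nonneg by (intro ennreal_mult[symmetric]) auto
      also have "2 powr r * b powr (W * r) * (4 * kernel_const * 2 powr ((1 + \<alpha>) * real j - P * real k))
         = (2 * K * 2 powr ((real j - P * real k) * W + ((1 + \<alpha>) * real j - P * real k) / r)) powr r"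
        using r kernel_const_nonneg
        by (simp add: K_def b_def powr_mult powr_powr powr_add distrib_right mult.assoc)
      finally show ?thesis
        using r K0 by (subst Lp_norm_le_iff) simp_all
    qed
    have term_le: "?c k j * Lp_norm (ennreal r) \<nu> (\<lambda>w. ennreal (?a k j w powr (1 / s)))
       \<le> ennreal (8 * K * x ^ k * y ^ j)" for k j
    proof -
      let ?e = "(real j - P * real k) * W + ((1 + \<alpha>) * real j - P * real k) / r"
      have "?c k j * Lp_norm (ennreal r) \<nu> (\<lambda>w. ennreal (?a k j w powr (1 / s)))
         \<le> ?c k j * ennreal (2 * K * 2 powr ?e)"
        by (intro mult_left_mono norm_a) auto
      also have "\<dots> = ennreal (4 * 2 ^ k * (1 / 2) ^ j * (2 * K * 2 powr ?e))"
        using K0 by (intro ennreal_mult[symmetric]) auto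
      also have "4 * 2 ^ k * (1 / 2) ^ j * (2 * K * 2 powr ?e)
         = 8 * K * (2 powr real k * 2 powr (- real j) * 2 powr ?e)"
        by (simp add: powr_minus powr_realpow power_one_over inverse_eq_divide)
      also have "2 powr real k * 2 powr (- real j) * 2 powr ?e
         = 2 powr ((1 - P * (W + 1 / r)) * real k) * 2 powr ((W + (1 + \<alpha>) / r - 1) * real j)"
        unfolding powr_add[symmetric] divide_inverse by (simp add: algebra_simps)
      also have "\<dots> = x ^ k * y ^ j" by (simp add: x_def y_def powr_of_nat_mult)
      finally show ?thesis by (simp add: mult.assoc)
    qed
    have "Lp_norm (ennreal r) \<nu> (\<lambda>w. Lp_norm (ennreal s) unit_interval (xray (\<lambda>x. ennreal (N x)) w) *
      indicator unit_circle w)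
      \<le> Lp_norm (ennreal r) \<nu> (\<lambda>w. 4 + (\<Sum>k. \<Sum>j. ?c k j * ennreal (?a k j w powr (1 / s))))"
    proof (rule Lp_norm_mono)
      fix w
      show "Lp_norm (ennreal s) unit_interval (xray (\<lambda>x. ennreal (N x)) w) * indicator unit_circle w
        \<le> 4 + (\<Sum>k. \<Sum>j. ?c k j * ennreal (?a k j w powr (1 / s)))"
        using Lp_norm_xray_le[OF N _ s, of w] by (cases "norm w = 1") auto
    qed (use r in simp)
    also have "\<dots> \<le> Lp_norm (ennreal r) \<nu> (\<lambda>w. 4) +
       Lp_norm (ennreal r) \<nu> (\<lambda>w. \<Sum>k. \<Sum>j. ?c k j * ennreal (?a k j w powr (1 / s)))"
      using r by (intro Lp_norm_add) measurable
    also have "Lp_norm (ennreal r) \<nu> (\<lambda>w. 4) \<le> ennreal m"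
    proof -
      have "Lp_norm (ennreal r) \<nu> (\<lambda>w. 4) \<le> 4 * ennreal_powr (emeasure \<nu> (space \<nu>)) (1 / r)"
        using r by (intro Lp_norm_le_const) auto
      also have "\<dots> = ennreal m"
        by (simp add: emeasure_eq_measure m_def ennreal_mult)
      finally show ?thesis .
    qed
    also have "Lp_norm (ennreal r) \<nu> (\<lambda>w. \<Sum>k. \<Sum>j. ?c k j * ennreal (?a k j w powr (1 / s)))
       \<le> (\<Sum>k. Lp_norm (ennreal r) \<nu> (\<lambda>w. \<Sum>j. ?c k j * ennreal (?a k j w powr (1 / s))))"
      using r by (intro Lp_norm_suminf) measurable
    also have "\<dots> \<le> (\<Sum>k. \<Sum>j. Lp_norm (ennreal r) \<nu> (\<lambda>w. ?c k j * ennreal (?a k j w powr (1 / s))))"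
      using r by (intro suminf_le Lp_norm_suminf) measurable
    also have "\<dots> = (\<Sum>k. \<Sum>j. ?c k j * Lp_norm (ennreal r) \<nu> (\<lambda>w. ennreal (?a k j w powr (1 / s))))"
      using r by (intro suminf_cong Lp_norm_cmult) auto
    also have "\<dots> \<le> (\<Sum>k. \<Sum>j. ennreal (8 * K * x ^ k * y ^ j))"
      by (intro suminf_le term_le) auto
    also have "\<dots> = ennreal S"
      using xy K0 by (subst suminf_geometric2) (simp_all add: S_def)
    also have "ennreal m + ennreal S = ennreal (m + S)"
      using m0 S0 by simp
    finally show "Lp_norm (ennreal r) \<nu> (\<lambda>w. Lp_norm (ennreal s) unit_interval (xray (\<lambda>x. ennreal (N x)) w) *
      indicator unit_circle w) \<le> ennreal (m + S)"
      by (simp add: add_left_mono)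
  qed (use m0 S0 in auto)
qed

end

section \<open>Bounds depending on level sets only\<close>

lemma unit_orthogonal_cases:
  fixes v w :: "real^2"
  assumes w: "norm w = 1" and v: "norm v = 1" and o: "orthogonal w v"
  shows "v = rot w \<or> v = - rot w"
proof -
  have sq: "w$1 * w$1 + w$2 * w$2 = 1" "v$1 * v$1 + v$2 * v$2 = 1" "w$1 * v$1 + w$2 * v$2 = 0"
    using w v o by (simp_all add: norm_eq_1 inner_vec2 orthogonal_def)
  define c where "c = rot w \<bullet> v"
  have "v = (w \<bullet> v) *\<^sub>R w + c *\<^sub>R rot w"
  proof -
    have "v$1 = (w$1 * w$1 + w$2 * w$2) * v$1" "v$2 = (w$1 * w$1 + w$2 * w$2) * v$2"
      by (simp_all add: sq)
    then show ?thesis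
      by (simp add: vec_eq_iff forall_2 c_def inner_vec2 algebra_simps)
  qed
  then have vc: "v = c *\<^sub>R rot w" using o by (simp add: orthogonal_def)
  have "norm (rot w) = 1" using w by (simp add: norm_eq_1)
  then have "\<bar>c\<bar> = 1" using v unfolding vc by simp
  then show ?thesis using vc by (auto simp: abs_if split: if_splits)
qed

text \<open>The other choice of perpendicular vector amounts to u -> -u, which preserves
  [-1,1].\<close>

lemma radon_eq_radon_rot:
  assumes w: "norm w = 1" and perp: "norm (perp w) = 1" "orthogonal w (perp w)"
  shows "radon perp f t w = radon rot f t w"
  using unit_orthogonal_cases[OF w perp]
proof
  assume p: "perp w = - rot w"
  have "radon rot f t w = (LINT u|lborel. indicat_real {-1..1} (0 + -1 * u) *\<^sub>R f (t *\<^sub>R w + (0 + -1 * u) *\<^sub>R rot w))"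
    unfolding radon_def set_lebesgue_integral_def
    by (subst lborel_integral_real_affine[where c="-1" and t=0]) simp_all
  also have "\<dots> = radon perp f t w"
    unfolding radon_def set_lebesgue_integral_def
    by (intro Bochner_Integration.integral_cong refl) (auto simp: p indicator_def)
  finally show ?thesis ..
qed (simp add: radon_def)

text \<open>This holds on every line: where the integrand is not integrable, the Bochner integral is
  0 by convention.\<close>

lemma norm_radon_le_xray: "ennreal (norm (radon rot f t w)) \<le> xray (\<lambda>x. ennreal (norm (f x))) w t"
proof -
  let ?g = "\<lambda>u. indicat_real {-1..1} u *\<^sub>R f (t *\<^sub>R w + u *\<^sub>R rot w)"
  have eq: "radon rot f t w = integral\<^sup>L lborel ?g"
    by (simp add: radon_def set_lebesgue_integral_def)
  show ?thesis
  proof (cases "integrable lborel ?g")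
    case True
    then have "ennreal (norm (radon rot f t w)) \<le> (\<integral>\<^sup>+u. ennreal (norm (?g u)) \<partial>lborel)"
      unfolding eq by (rule integral_norm_bound_ennreal)
    also have "\<dots> = xray (\<lambda>x. ennreal (norm (f x))) w t"
      unfolding xray_def by (intro nn_integral_cong) (simp add: indicator_def)
    finally show ?thesis .
  next
    case False
    then show ?thesis unfolding eq by (simp add: not_integrable_integral_eq)
  qed
qed

lemma borel_measurable_Lp_norm_unit_interval:
  assumes s: "0 < s" and [measurable]: "case_prod g \<in> borel_measurable (borel \<Otimes>\<^sub>M M)"
  shows "(\<lambda>w. Lp_norm (ennreal s) unit_interval (\<lambda>t. g t w)) \<in> borel_measurable M"
proof -
  have "(\<lambda>w. Lp_norm (ennreal s) unit_interval (\<lambda>t. g t w))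
     = (\<lambda>w. ennreal_powr (\<integral>\<^sup>+t. ennreal_powr (g t w) s * indicator {-1..1} t \<partial>lborel) (1 / s))"
    using s by (simp add: Lp_norm_ennreal nn_integral_restrict_space)
  also have "\<dots> \<in> borel_measurable M" by measurable
  finally show ?thesis .
qed

lemma borel_measurable_radon_rot:
  assumes [measurable]: "f \<in> borel_measurable borel"
  shows "(\<lambda>(t, w). radon rot f t w) \<in> borel_measurable (borel \<Otimes>\<^sub>M borel)"
  unfolding radon_def set_lebesgue_integral_def by measurable

text \<open>Chebyshev's inequality for the P-th power of \<open>N\<close> at height 2^(kP).\<close>

lemma emeasure_level_set_le:
  fixes P :: real
  assumes [measurable]: "N \<in> borel_measurable borel" and P: "0 < P"
    and int: "(\<integral>\<^sup>+x. ennreal (N x powr P) \<partial>lborel) \<le> 1"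
  shows "emeasure lborel (level_set N k) \<le> ennreal (2 powr (- P * real k))"
proof -
  have "ennreal (2 powr (P * real k)) * emeasure lborel (level_set N k)
     = (\<integral>\<^sup>+x. ennreal (2 powr (P * real k)) * indicator (level_set N k) x \<partial>lborel)"
    by (intro nn_integral_cmult_indicator[symmetric]) measurable
  also have "\<dots> \<le> (\<integral>\<^sup>+x. ennreal (N x powr P) \<partial>lborel)"
  proof (intro nn_integral_mono)
    fix x
    have "2 powr (P * real k) \<le> N x powr P" if "2 ^ k < N x"
    proof -
      have "(2 ^ k) powr P \<le> N x powr P" using that P by (intro powr_mono2) auto
      then show ?thesis by (simp add: powr_powr mult.commute flip: powr_realpow)
    qed
    then show "ennreal (2 powr (P * real k)) * indicator (level_set N k) x \<le> ennreal (N x powr P)"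
      by (auto simp: indicator_def level_set_def intro!: ennreal_leI)
  qed
  also note int
  finally have "ennreal (2 powr (- P * real k)) * (ennreal (2 powr (P * real k)) * emeasure lborel (level_set N k))
     \<le> ennreal (2 powr (- P * real k)) * 1" by (intro mult_left_mono) auto
  moreover have "ennreal (2 powr (- P * real k)) * ennreal (2 powr (P * real k)) = 1"
    by (simp flip: ennreal_mult powr_add)
  ultimately show ?thesis by (simp add: mult.assoc[symmetric])
qed

text \<open>With \<open>x = 1/p\<close>, \<open>y = 1/q\<close>, \<open>z = 1/s\<close>, the exponent \<open>q\<close> is raised to \<open>1/\<eta>\<close>. The last two
  conclusions give decay in \<open>\<rho>\<close> and in \<open>k\<close>.\<close>
lemma exists_exponents:
  fixes \<alpha> x y z :: real
  assumes "0 < \<alpha>" "0 < x" "z \<le> x" "0 < y" "2 * x < 1 + z" "x < z + \<alpha> * y" "(1 - \<alpha>) * x < z"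
  obtains \<eta> W where "0 < \<eta>" "\<eta> \<le> y" "0 \<le> W" "W + (1 - \<alpha>) * \<eta> \<le> z" "W + (1 + \<alpha>) * \<eta> < 1" "x < W + \<eta>"
proof -
  \<comment> \<open>The exponent \<eta> must exceed (x-z)/\<alpha>. The hypotheses 2x < 1+z, x < z +
    \<alpha> y and (1-\<alpha>)x < z say exactly that this number lies below (1-x)/\<alpha>, y and
    x, respectively.\<close>
  define U where "U = min ((1 - x) / \<alpha>) (min x y)"
  have "(x - z) / \<alpha> < U"
  proof -
    have "(x - z) / \<alpha> < (1 - x) / \<alpha>" using assms by (intro divide_strict_right_mono) auto
    moreover have "(x - z) / \<alpha> < x" "(x - z) / \<alpha> < y"
      using assms by (auto simp: pos_divide_less_eq algebra_simps)
    ultimately show ?thesis by (simp add: U_def)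
  qed
  then obtain \<eta> where \<eta>: "(x - z) / \<alpha> < \<eta>" "\<eta> < U" using dense by blast
  have "0 \<le> (x - z) / \<alpha>" using assms by simp
  then have \<eta>0: "0 < \<eta>" using \<eta> by linarith
  have u: "x - z < \<alpha> * \<eta>" "\<alpha> * \<eta> < 1 - x" "\<eta> < x" "\<eta> < y"
    using \<eta> assms by (auto simp: U_def field_simps)
  \<comment> \<open>For W = x - \<eta> + e the last three conclusions read e \<le> z - x + \<alpha>
    \<eta>, e < 1 - x - \<alpha> \<eta> and 0 < e. Half the smaller margin satisfies them
    all.\<close>
  define e where "e = min (1 - x - \<alpha> * \<eta>) (z - x + \<alpha> * \<eta>) / 2"
  have e: "0 < e" "e < 1 - x - \<alpha> * \<eta>" "e \<le> z - x + \<alpha> * \<eta>" using u by (auto simp: e_def)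
  show ?thesis
  proof (rule that[of \<eta> "x - \<eta> + e"])
    show "x - \<eta> + e + (1 - \<alpha>) * \<eta> \<le> z" "x - \<eta> + e + (1 + \<alpha>) * \<eta> < 1"
      using e by (simp_all add: algebra_simps)
  qed (use u e \<eta>0 in auto)
qed

text \<open>The function \<open>h\<close> stands for \<open>\<omega> \<mapsto> \<parallel>Rf(\<cdot>, \<omega>)\<parallel>\<^sub>s\<close>; the scale \<open>A\<close>
  for the norm of \<open>f\<close> and \<open>N\<close> for \<open>\<bar>f\<bar> / A\<close>. Only the sizes of the dyadic level sets of \<open>N\<close>
  matter, so \<open>P\<close> may be any finite number when \<open>p = \<infinity>\<close>.\<close>
definition level_set_bound :: "(real^2) measure \<Rightarrow> ennreal \<Rightarrow> real \<Rightarrow> real \<Rightarrow> real \<Rightarrow> bool" where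
  "level_set_bound \<mu> q s P B \<longleftrightarrow> (\<forall>N A h. N \<in> borel_measurable borel \<longrightarrow>
     (\<forall>k. emeasure lborel (level_set N k) \<le> ennreal (2 powr (- P * real k))) \<longrightarrow>
     0 \<le> A \<longrightarrow> h \<in> borel_measurable \<mu> \<longrightarrow>
     (\<forall>w\<in>unit_circle. h w \<le> ennreal A * Lp_norm (ennreal s) unit_interval (xray (\<lambda>x. ennreal (N x)) w)) \<longrightarrow>
     Lp_norm q \<mu> h \<le> ennreal (A * B))"

context
  fixes \<alpha> :: real and \<mu> :: "(real^2) measure"
  assumes alpha: "0 < \<alpha>" "\<alpha> < 1"
    and sets_mu: "sets \<mu> = sets (restrict_space borel unit_circle)"
    and dim: "alpha_dimensional \<alpha> \<mu>"
begin

lemma space_mu: "space \<mu> = unit_circle"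
  using sets_eq_imp_space_eq[OF sets_mu] by (simp add: space_restrict_space)

lemma measurable_id_mu: "(\<lambda>x. x) \<in> \<mu> \<rightarrow>\<^sub>M borel"
  unfolding measurable_cong_sets[OF sets_mu refl] by (intro measurable_restrict_space1) simp

lemma circle_measure_distr: "\<exists>C. circle_measure (distr \<mu> borel (\<lambda>x. x)) \<alpha> C"
proof -
  from dim obtain C0 where C0: "\<And>w \<delta>. w \<in> unit_circle \<Longrightarrow> 0 < \<delta> \<Longrightarrow>
      emeasure \<mu> (ball w \<delta> \<inter> unit_circle) \<le> ennreal (C0 * \<delta> powr \<alpha>)"
    unfolding alpha_dimensional_def by blast
  have em: "emeasure (distr \<mu> borel (\<lambda>x. x)) S = emeasure \<mu> (S \<inter> unit_circle)" if "S \<in> sets borel" for S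
    using that by (simp add: emeasure_distr measurable_id_mu space_mu)
  have e1: "axis 1 1 \<in> unit_circle" by simp
  \<comment> \<open>The radius 3 exceeds the diameter of the circle, so one ball contains it and the
    dimension condition gives finite total mass.\<close>
  have "emeasure (distr \<mu> borel (\<lambda>x. x)) UNIV = emeasure \<mu> (ball (axis 1 1) 3 \<inter> unit_circle)"
  proof -
    have "dist (axis 1 1) w < 3" if "norm w = 1" for w :: "real^2"
      using dist_triangle2[of "axis 1 1" w 0] that e1 by (simp add: dist_norm)
    then have "ball (axis 1 1) 3 \<inter> unit_circle = UNIV \<inter> (unit_circle :: (real^2) set)" by auto
    then show ?thesis by (simp add: em)
  qed
  also have "\<dots> < \<infinity>" by (rule order_le_less_trans[OF C0[OF e1]]) simp_all
  finally have "finite_measure (distr \<mu> borel (\<lambda>x. x))" by (intro finite_measureI) simp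
  \<comment> \<open>The constant of \<open>alpha_dimensional\<close> may have any sign, while the
    locale asks for a nonnegative one.\<close>
  moreover have "emeasure (distr \<mu> borel (\<lambda>x. x)) (ball w \<delta>) \<le> ennreal (max C0 0 * \<delta> powr \<alpha>)"
    if "norm w = 1" "0 < \<delta>" for w \<delta>
  proof -
    have "emeasure \<mu> (ball w \<delta> \<inter> unit_circle) \<le> ennreal (C0 * \<delta> powr \<alpha>)" using that by (intro C0) auto
    also have "\<dots> \<le> ennreal (max C0 0 * \<delta> powr \<alpha>)" by (intro ennreal_leI mult_right_mono) auto
    finally show ?thesis by (simp add: em)
  qed
  ultimately have "circle_measure (distr \<mu> borel (\<lambda>x. x)) \<alpha> (max C0 0)"
    using alpha by (simp add: circle_measure_def circle_measure_axioms_def)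
  then show ?thesis ..
qed

lemma emeasure_mu_finite: "emeasure \<mu> (space \<mu>) < \<infinity>"
proof -
  from circle_measure_distr obtain C where "circle_measure (distr \<mu> borel (\<lambda>x. x)) \<alpha> C" ..
  then interpret circle_measure "distr \<mu> borel (\<lambda>x. x)" \<alpha> C .
  have "emeasure \<mu> (space \<mu>) = emeasure (distr \<mu> borel (\<lambda>x. x)) UNIV"
    by (simp add: emeasure_distr measurable_id_mu space_mu)
  also have "\<dots> < \<infinity>" by (simp add: less_top[symmetric])
  finally show ?thesis .
qed

text \<open>A bound uniform in the direction gives every q-norm because the total mass is finite;
  \<open>m\<close> below accounts for that mass, with value 1 for q = \<infinity>.\<close>

lemma level_set_bound_pointwise:
  assumes q: "1 \<le> q" and s: "1 \<le> s" and W: "0 < W" "W \<le> 1 / s" "W < 1" "1 < P * W"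
  shows "\<exists>B\<ge>0. level_set_bound \<mu> q s P B"
proof -
  from circle_measure_distr obtain C where "circle_measure (distr \<mu> borel (\<lambda>x. x)) \<alpha> C" ..
  then interpret circle_measure "distr \<mu> borel (\<lambda>x. x)" \<alpha> C .
  from xray_bound_pointwise[OF s W] obtain B where B: "0 \<le> B"
    "\<And>N w. N \<in> borel_measurable borel \<Longrightarrow>
      \<forall>k. emeasure lborel (level_set N k) \<le> ennreal (2 powr (- P * real k)) \<Longrightarrow>
      norm w = 1 \<Longrightarrow> Lp_norm (ennreal s) unit_interval (xray (\<lambda>x. ennreal (N x)) w) \<le> ennreal B"
    by blast
  define m where "m = (if q = \<infinity> then 1 else enn2real (ennreal_powr (emeasure \<mu> (space \<mu>)) (1 / enn2real q)))"
  have m0: "0 \<le> m" by (simp add: m_def)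
  have "level_set_bound \<mu> q s P (B * m)"
    unfolding level_set_bound_def
  proof (intro allI impI)
    fix N A and h :: "real^2 \<Rightarrow> ennreal"
    assume N: "N \<in> borel_measurable borel"
      and E: "\<forall>k. emeasure lborel (level_set N k) \<le> ennreal (2 powr (- P * real k))"
      and A: "0 \<le> A" and hm: "h \<in> borel_measurable \<mu>"
      and h: "\<forall>w\<in>unit_circle. h w \<le> ennreal A * Lp_norm (ennreal s) unit_interval (xray (\<lambda>x. ennreal (N x)) w)"
    have hb: "h w \<le> ennreal (A * B)" if "w \<in> space \<mu>" for w
    proof -
      have "h w \<le> ennreal A * Lp_norm (ennreal s) unit_interval (xray (\<lambda>x. ennreal (N x)) w)"
        using h that by (simp add: space_mu)
      also have "\<dots> \<le> ennreal A * ennreal B"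
        using that by (intro mult_left_mono B N E) (simp_all add: space_mu)
      finally show ?thesis using A B by (simp add: ennreal_mult)
    qed
    show "Lp_norm q \<mu> h \<le> ennreal (A * (B * m))"
    proof (cases q)
      case top
      then show ?thesis using hb hm by (auto simp: Lp_norm_def m_def intro!: esssup_I AE_I2)
    next
      case (real r)
      then have "1 \<le> r" using q by (simp add: ennreal_1[symmetric] del: ennreal_1)
      then have "Lp_norm q \<mu> h \<le> ennreal (A * B) * ennreal_powr (emeasure \<mu> (space \<mu>)) (1 / r)"
        unfolding real using hb by (intro Lp_norm_le_const) auto
      also have "ennreal_powr (emeasure \<mu> (space \<mu>)) (1 / r) = ennreal m"
        using emeasure_mu_finite real by (cases "emeasure \<mu> (space \<mu>)") (auto simp: m_def)
      finally show ?thesis using A B m0 by (simp add: mult.assoc flip: ennreal_mult)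
    qed
  qed
  then show ?thesis using B m0 by (intro exI[of _ "B * m"]) auto
qed

text \<open>The mixed bound is applied with the exponent \<open>r\<close> and then lowered to
  \<open>q\<close> on a finite measure space.\<close>

lemma level_set_bound_mixed:
  assumes q: "1 \<le> q" and s: "1 \<le> s" and r: "q \<le> r"
    and W: "0 \<le> W" "W + (1 - \<alpha>) / r \<le> 1 / s" "W + (1 + \<alpha>) / r < 1" "1 < P * (W + 1 / r)"
  shows "\<exists>B\<ge>0. level_set_bound \<mu> (ennreal q) s P B"
proof -
  from circle_measure_distr obtain C where "circle_measure (distr \<mu> borel (\<lambda>x. x)) \<alpha> C" ..
  then interpret circle_measure "distr \<mu> borel (\<lambda>x. x)" \<alpha> C .
  have r1: "1 \<le> r" using q r by simp
  let ?H = "\<lambda>N w. Lp_norm (ennreal s) unit_interval (xray (\<lambda>x. ennreal (N x)) w)"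
  from xray_bound_mixed[OF s r1 W] obtain B where B: "0 \<le> B"
    "\<And>N. N \<in> borel_measurable borel \<Longrightarrow>
      \<forall>k. emeasure lborel (level_set N k) \<le> ennreal (2 powr (- P * real k)) \<Longrightarrow>
      Lp_norm (ennreal r) (distr \<mu> borel (\<lambda>x. x)) (\<lambda>w. ?H N w * indicator unit_circle w) \<le> ennreal B"
    by blast
  define m where "m = enn2real (ennreal_powr (emeasure \<mu> (space \<mu>) + 1) (1 / q))"
  have m0: "0 \<le> m" by (simp add: m_def)
  \<comment> \<open>\<open>B + 1\<close> replaces \<open>B\<close> because the comparison of
    exponents requires a strictly positive bound.\<close>
  have "level_set_bound \<mu> (ennreal q) s P (m * (B + 1))"
    unfolding level_set_bound_def
  proof (intro allI impI)
    fix N A and h :: "real^2 \<Rightarrow> ennreal"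
    assume N [measurable]: "N \<in> borel_measurable borel"
      and E: "\<forall>k. emeasure lborel (level_set N k) \<le> ennreal (2 powr (- P * real k))"
      and A: "0 \<le> A" and hm: "h \<in> borel_measurable \<mu>"
      and h: "\<forall>w\<in>unit_circle. h w \<le> ennreal A * ?H N w"
    have [measurable]: "unit_circle \<in> sets (borel :: (real^2) measure)" by simp
    have HN [measurable]: "?H N \<in> borel_measurable borel"
      using s by (intro borel_measurable_Lp_norm_unit_interval) auto
    have HN' [measurable]: "(\<lambda>w. ?H N w * indicator unit_circle w) \<in> borel_measurable borel" by measurable
    have HNmu [measurable]: "(\<lambda>w. ?H N w * indicator unit_circle w) \<in> borel_measurable \<mu>"
      using measurable_compose[OF measurable_id_mu HN'] by simp
    have "Lp_norm (ennreal r) (distr \<mu> borel (\<lambda>x. x)) (\<lambda>w. ?H N w * indicator unit_circle w)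
       = Lp_norm (ennreal r) \<mu> (\<lambda>w. ?H N w * indicator unit_circle w)"
      using r1 measurable_id_mu by (simp add: Lp_norm_ennreal nn_integral_distr)
    with B(2)[OF N E] have "Lp_norm (ennreal r) \<mu> (\<lambda>w. ?H N w * indicator unit_circle w) \<le> ennreal B"
      by simp
    also have "\<dots> \<le> ennreal (B + 1)" by (intro ennreal_leI) simp
    finally have "Lp_norm (ennreal q) \<mu> (\<lambda>w. ?H N w * indicator unit_circle w)
       \<le> ennreal_powr (emeasure \<mu> (space \<mu>) + 1) (1 / q) * ennreal (B + 1)"
      using q r B by (intro Lp_norm_le_of_larger_exponent) auto
    also have "ennreal_powr (emeasure \<mu> (space \<mu>) + 1) (1 / q) = ennreal m"
    proof -
      obtain e where "emeasure \<mu> (space \<mu>) = ennreal e" "0 \<le> e"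
        using emeasure_mu_finite by (cases "emeasure \<mu> (space \<mu>)") auto
      then have "emeasure \<mu> (space \<mu>) + 1 = ennreal (e + 1)" "0 \<le> e + 1" by simp_all
      then show ?thesis by (simp only: m_def ennreal_powr_ennreal) simp
    qed
    finally have Hq: "Lp_norm (ennreal q) \<mu> (\<lambda>w. ?H N w * indicator unit_circle w) \<le> ennreal m * ennreal (B + 1)" .
    have "Lp_norm (ennreal q) \<mu> h \<le> Lp_norm (ennreal q) \<mu> (\<lambda>w. ennreal A * (?H N w * indicator unit_circle w))"
      using q h by (intro Lp_norm_mono) (auto simp: space_mu)
    also have "\<dots> = ennreal A * Lp_norm (ennreal q) \<mu> (\<lambda>w. ?H N w * indicator unit_circle w)"
      using q by (intro Lp_norm_cmult) auto
    also have "\<dots> \<le> ennreal A * (ennreal m * ennreal (B + 1))"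
      by (intro mult_left_mono Hq) auto
    also have "\<dots> = ennreal (A * (m * (B + 1)))"
      using A B m0 by (simp add: ennreal_mult)
    finally show "Lp_norm (ennreal q) \<mu> h \<le> ennreal (A * (m * (B + 1)))" .
  qed
  then show ?thesis using B m0 by (intro exI[of _ "m * (B + 1)"]) auto
qed

end

section \<open>The mixed norm estimate\<close>

text \<open>For p = \<infinity>, |f|/A is at most 1 almost everywhere, so all level sets are null
  and any P works. For finite p this is Chebyshev's inequality after normalisation.\<close>

lemma emeasure_level_set_scaled_le:
  fixes f :: "real^2 \<Rightarrow> complex" and p :: ennreal
  assumes [measurable]: "f \<in> borel_measurable borel" and A: "0 < A"
    and f: "Lp_norm p lborel (\<lambda>x. ennreal (norm (f x))) \<le> ennreal A"
    and p: "p = \<infinity> \<or> p = ennreal P" and P: "0 < P"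
  shows "emeasure lborel (level_set (\<lambda>x. norm (f x) / A) k) \<le> ennreal (2 powr (- P * real k))"
  using p
proof
  assume "p = \<infinity>"
  then have "esssup lborel (\<lambda>x. ennreal (norm (f x))) \<le> ennreal A" using f by (simp add: Lp_norm_def)
  with esssup_AE[of "\<lambda>x. ennreal (norm (f x))" lborel]
  have "AE x in lborel. ennreal (norm (f x)) \<le> ennreal A" by (auto elim!: eventually_mono)
  then have "AE x in lborel. x \<notin> level_set (\<lambda>x. norm (f x) / A) k"
  proof eventually_elim
    case (elim x)
    then have "norm (f x) / A \<le> 1" using A by simp
    also have "(1::real) \<le> 2 ^ k" by simp
    finally show ?case by (simp add: level_set_def)
  qed
  then have "emeasure lborel (level_set (\<lambda>x. norm (f x) / A) k) = 0"
    by (subst (asm) AE_iff_measurable[OF _ refl]) auto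
  then show ?thesis by simp
next
  assume p: "p = ennreal P"
  show ?thesis
  proof (rule emeasure_level_set_le)
    have "(\<integral>\<^sup>+x. ennreal (norm (f x) powr P) \<partial>lborel) \<le> ennreal (A powr P)"
      using f P A unfolding p by (simp add: Lp_norm_le_iff)
    then have "ennreal (A powr - P) * (\<integral>\<^sup>+x. ennreal (norm (f x) powr P) \<partial>lborel)
       \<le> ennreal (A powr - P) * ennreal (A powr P)" by (intro mult_left_mono) auto
    also have "\<dots> = 1" using A by (simp flip: ennreal_mult powr_add)
    also have "ennreal (A powr - P) * (\<integral>\<^sup>+x. ennreal (norm (f x) powr P) \<partial>lborel)
       = (\<integral>\<^sup>+x. ennreal (A powr - P) * ennreal (norm (f x) powr P) \<partial>lborel)"
      by (intro nn_integral_cmult[symmetric]) measurable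
    also have "\<dots> = (\<integral>\<^sup>+x. ennreal ((norm (f x) / A) powr P) \<partial>lborel)"
      using A by (intro nn_integral_cong) (simp add: powr_divide powr_minus field_simps flip: ennreal_mult)
    finally show "(\<integral>\<^sup>+x. ennreal ((norm (f x) / A) powr P) \<partial>lborel) \<le> 1" .
  qed (use P in auto)
qed

text \<open>Let x = 1/p and z = 1/s. If p = \<infinity> or x < z, the pointwise bound suffices.
  Otherwise \<open>q\<close> is finite and the mixed bound applies with the exponents from
  \<open>exists_exponents\<close>.\<close>

lemma exists_level_set_bound:
  fixes \<alpha> z :: real and \<mu> :: "(real^2) measure" and p q :: ennreal
  assumes alpha: "0 < \<alpha>" "\<alpha> < 1"
    and mu: "sets \<mu> = sets (restrict_space borel unit_circle)" "alpha_dimensional \<alpha> \<mu>"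
    and pqs: "1 \<le> p" "1 \<le> q" "1 \<le> s"
    and c1: "2 / p < 1 + 1 / ennreal s"
    and c2: "1 / p < 1 / ennreal s + ennreal \<alpha> / q"
    and c3: "ennreal (1 - \<alpha>) / p < 1 / ennreal s"
  shows "\<exists>P B. 0 < P \<and> (p = \<infinity> \<or> p = ennreal P) \<and> 0 \<le> B \<and> level_set_bound \<mu> q s P B"
proof -
  have div: "ennreal a / ennreal b = ennreal (a / b)" if "0 \<le> a" "0 < b" for a b
    using that by (rule divide_ennreal)
  have inv_s: "1 / ennreal s = ennreal (1 / s)" using div[of 1 s] pqs by simp
  define z where "z = 1 / s"
  have z: "0 < z" "z \<le> 1" using pqs by (simp_all add: z_def)
  show ?thesis
  proof (cases p)
    case top
    \<comment> \<open>Here P is free: the choices P = 4/z and W = z/2 make P W = 2 > 1.\<close>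
    have "\<exists>B\<ge>0. level_set_bound \<mu> q s (4 / z) B"
      by (rule level_set_bound_pointwise[OF alpha mu pqs(2,3), of "z / 2"]) (use z in \<open>simp_all flip: z_def\<close>)
    moreover have "0 < 4 / z" "p = \<infinity>" using z top by simp_all
    ultimately show ?thesis by blast
  next
    case (real P)
    then have P1: "1 \<le> P" using pqs by (simp add: ennreal_1[symmetric] del: ennreal_1)
    then have P0: "0 < P" by simp
    define x where "x = 1 / P"
    have x: "0 < x" "x \<le> 1" "P * x = 1" using P1 by (simp_all add: x_def)
    have ip: "1 / p = ennreal x" "2 / p = ennreal (2 * x)" "ennreal (1 - \<alpha>) / p = ennreal ((1 - \<alpha>) * x)"
      using div[of 1 P] div[of 2 P] div[of "1 - \<alpha>" P] P1 alpha by (simp_all add: real x_def)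
    have r1: "2 * x < 1 + z"
    proof -
      have "ennreal (2 * x) < ennreal (1 + z)" using c1 z by (simp add: ip inv_s z_def)
      then show ?thesis using x by (subst (asm) ennreal_less_iff) auto
    qed
    have r3: "(1 - \<alpha>) * x < z"
    proof -
      have "ennreal ((1 - \<alpha>) * x) < ennreal z" using c3 by (simp add: ip inv_s z_def)
      then show ?thesis using x alpha by (subst (asm) ennreal_less_iff) auto
    qed
    show ?thesis
    proof (cases "x < z")
      case True
      have "\<exists>B\<ge>0. level_set_bound \<mu> q s P B"
      proof (rule level_set_bound_pointwise[OF alpha mu pqs(2,3), of "(x + z) / 2"])
        have "P * x < P * ((x + z) / 2)" using True P1 by (intro mult_strict_left_mono) auto
        then show "1 < P * ((x + z) / 2)" using x by simp
      qed (use True x z in \<open>simp_all flip: z_def\<close>)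
      with P0 real show ?thesis by blast
    next
      case False
      \<comment> \<open>For q = \<infinity> the second inequality would reduce to x < z.\<close>
      have "q \<noteq> top"
      proof
        assume "q = top"
        then have "ennreal x < ennreal z" using c2 by (simp add: ip inv_s z_def)
        then show False using False x by (simp add: ennreal_less_iff)
      qed
      then obtain Q where Q: "q = ennreal Q" "0 \<le> Q" by (cases q) auto
      then have Q1: "1 \<le> Q" using pqs by (simp add: ennreal_1[symmetric] del: ennreal_1)
      define y where "y = 1 / Q"
      have y: "0 < y" using Q1 by (simp add: y_def)
      have r2: "x < z + \<alpha> * y"
      proof -
        have "ennreal \<alpha> / q = ennreal (\<alpha> * y)" using div[of \<alpha> Q] Q Q1 alpha by (simp add: y_def)
        then have "ennreal x < ennreal z + ennreal (\<alpha> * y)" using c2 by (simp add: ip inv_s z_def)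
        also have "\<dots> = ennreal (z + \<alpha> * y)" using z y alpha by (intro ennreal_plus[symmetric]) auto
        finally show ?thesis using x by (subst (asm) ennreal_less_iff) auto
      qed
      obtain \<eta> W where \<eta>: "0 < \<eta>" "\<eta> \<le> y" "0 \<le> W" "W + (1 - \<alpha>) * \<eta> \<le> z" "W + (1 + \<alpha>) * \<eta> < 1" "x < W + \<eta>"
        using exists_exponents[of \<alpha> x z y] alpha x False y r1 r2 r3 by auto
      have "\<exists>B\<ge>0. level_set_bound \<mu> (ennreal Q) s P B"
      proof (rule level_set_bound_mixed[OF alpha mu Q1 pqs(3), of "1 / \<eta>" W])
        show "Q \<le> 1 / \<eta>" using \<eta> Q1 by (simp add: y_def field_simps)
        have "P * x < P * (W + \<eta>)" using \<eta> P1 by (intro mult_strict_left_mono) auto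
        then show "1 < P * (W + 1 / (1 / \<eta>))" using x by simp
      qed (use \<eta> in \<open>auto simp: z_def\<close>)
      with P0 real Q show ?thesis by blast
    qed
  qed
qed

theorem theorem1p1:
  fixes \<alpha> :: real and \<mu> :: "(real^2) measure" and p q s :: ennreal
    and perp :: "real^2 \<Rightarrow> real^2"
  assumes "0 < \<alpha>" and "\<alpha> < 1"
    and "sets \<mu> = sets (restrict_space borel unit_circle)"
    and "alpha_dimensional \<alpha> \<mu>"
    and "\<forall>\<omega>\<in>unit_circle. perp \<omega> \<in> unit_circle \<and> orthogonal \<omega> (perp \<omega>)"
    and "1 \<le> p" and "1 \<le> q" and "1 \<le> s"
    and "2 / p < 1 + 1 / s"
    and "1 / p < 1 / s + ennreal \<alpha> / q"
    and "ennreal (1 - \<alpha>) / p < 1 / s"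
  shows "\<exists>C::real. 0 \<le> C \<and>
    (\<forall>f :: real^2 \<Rightarrow> complex.
       f \<in> borel_measurable borel \<longrightarrow>
       Lp_norm p lborel (\<lambda>x. ennreal (norm (f x))) < \<infinity> \<longrightarrow>
       Lp_norm q \<mu> (\<lambda>\<omega>. Lp_norm s (restrict_space lborel {-1..1})
                          (\<lambda>t. ennreal (norm (radon perp f t \<omega>))))
         \<le> ennreal C * Lp_norm p lborel (\<lambda>x. ennreal (norm (f x))))"
proof -
  \<comment> \<open>For s = \<infinity> the right-hand side of the third inequality would be
    0.\<close>
  have "s \<noteq> top" using assms(11) by auto
  then obtain \<sigma> where \<sigma>: "s = ennreal \<sigma>" "0 \<le> \<sigma>" by (cases s) auto
  then have \<sigma>1: "1 \<le> \<sigma>" using assms(8) by (simp add: ennreal_1[symmetric] del: ennreal_1)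
  obtain P B where P: "0 < P" "p = \<infinity> \<or> p = ennreal P" and B: "0 \<le> B" "level_set_bound \<mu> q \<sigma> P B"
    using exists_level_set_bound[OF assms(1-4,6,7) \<sigma>1] assms(9-11) unfolding \<sigma> by blast
  show ?thesis
  proof (intro exI[of _ B] conjI allI impI B(1))
    fix f :: "real^2 \<Rightarrow> complex"
    assume f [measurable]: "f \<in> borel_measurable borel"
      and fin: "Lp_norm p lborel (\<lambda>x. ennreal (norm (f x))) < \<infinity>"
    define h where "h \<omega> = Lp_norm s unit_interval (\<lambda>t. ennreal (norm (radon perp f t \<omega>)))" for \<omega>
    have rot_eq: "radon perp f t w = radon rot f t w" if "w \<in> unit_circle" for t w
      using that assms(5) by (intro radon_eq_radon_rot) auto
    \<comment> \<open>Measurability is obtained for \<open>rot\<close> and transferred: on the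
      circle, the whole space of \<open>\<mu>\<close>, both transforms agree, even if
      \<open>perp\<close> is not measurable.\<close>
    have h_meas: "h \<in> borel_measurable \<mu>"
    proof -
      note borel_measurable_radon_rot[OF f, measurable]
      have "(\<lambda>\<omega>. Lp_norm (ennreal \<sigma>) unit_interval (\<lambda>t. ennreal (norm (radon rot f t \<omega>)))) \<in> borel_measurable borel"
        using \<sigma>1 by (intro borel_measurable_Lp_norm_unit_interval) (auto simp: split_beta')
      from measurable_compose[OF measurable_id_mu[OF assms(1-4)] this]
      have "(\<lambda>\<omega>. Lp_norm s unit_interval (\<lambda>t. ennreal (norm (radon rot f t \<omega>)))) \<in> borel_measurable \<mu>"
        by (simp add: \<sigma>)
      then show ?thesis
        by (rule measurable_cong[THEN iffD2, rotated])
          (simp add: h_def rot_eq space_mu[OF assms(1-4)])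
    qed
    \<comment> \<open>\<open>A\<close> is any positive upper bound of the norm, so that dividing by
      it makes sense even when the norm is 0.\<close>
    have scaled: "Lp_norm q \<mu> h \<le> ennreal (A * B)"
      if A: "0 < A" and fA: "Lp_norm p lborel (\<lambda>x. ennreal (norm (f x))) \<le> ennreal A" for A
    proof -
      let ?N = "\<lambda>x. norm (f x) / A"
      have "h w \<le> ennreal A * Lp_norm (ennreal \<sigma>) unit_interval (xray (\<lambda>x. ennreal (?N x)) w)"
        if w: "w \<in> unit_circle" for w
      proof -
        have "h w \<le> Lp_norm (ennreal \<sigma>) unit_interval (\<lambda>t. ennreal A * xray (\<lambda>x. ennreal (?N x)) w t)"
          unfolding h_def \<sigma>
        proof (rule Lp_norm_mono)
          fix t
          have "ennreal (norm (radon perp f t w)) \<le> xray (\<lambda>x. ennreal (norm (f x))) w t"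
            unfolding rot_eq[OF w] by (rule norm_radon_le_xray)
          also have "\<dots> = (\<integral>\<^sup>+u. ennreal A * (ennreal (?N (t *\<^sub>R w + u *\<^sub>R rot w)) * indicator {-1..1} u) \<partial>lborel)"
            unfolding xray_def using A by (intro nn_integral_cong) (simp add: mult.assoc[symmetric] flip: ennreal_mult)
          also have "\<dots> = ennreal A * xray (\<lambda>x. ennreal (?N x)) w t"
            unfolding xray_def by (intro nn_integral_cmult) measurable
          finally show "ennreal (norm (radon perp f t w)) \<le> ennreal A * xray (\<lambda>x. ennreal (?N x)) w t" .
        qed (use \<sigma>1 in simp)
        also have "\<dots> = ennreal A * Lp_norm (ennreal \<sigma>) unit_interval (xray (\<lambda>x. ennreal (?N x)) w)"
          using \<sigma>1 by (intro Lp_norm_cmult measurable_restrict_space1) measurable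
        finally show ?thesis .
      qed
      moreover have "emeasure lborel (level_set ?N k) \<le> ennreal (2 powr (- P * real k))" for k
        using f A fA P(2,1) by (rule emeasure_level_set_scaled_le)
      ultimately show ?thesis
        using B(2) h_meas A unfolding level_set_bound_def by (elim allE[of _ ?N] allE[of _ A] allE[of _ h]) simp
    qed
    obtain n where n: "Lp_norm p lborel (\<lambda>x. ennreal (norm (f x))) = ennreal n" "0 \<le> n"
      using fin by (cases "Lp_norm p lborel (\<lambda>x. ennreal (norm (f x)))") auto
    have "Lp_norm q \<mu> h \<le> ennreal (B * n)"
    proof (rule ennreal_le_epsilon)
      fix e :: real assume e: "0 < e"
      \<comment> \<open>The scale n + d is positive even for n = 0, and this d exceeds the target
        bound B n by at most e.\<close>
      define d where "d = e / (B + 1)"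
      have d: "0 < d" "d * B \<le> e" using e B by (auto simp: d_def field_simps)
      have "Lp_norm q \<mu> h \<le> ennreal ((n + d) * B)"
        using n d by (intro scaled) (auto intro!: ennreal_leI)
      also have "\<dots> \<le> ennreal (B * n + e)"
        using d by (intro ennreal_leI) (simp add: algebra_simps)
      also have "\<dots> = ennreal (B * n) + ennreal e" using B n e by (intro ennreal_plus) auto
      finally show "Lp_norm q \<mu> h \<le> ennreal (B * n) + ennreal e" .
    qed
    then show "Lp_norm q \<mu> (\<lambda>\<omega>. Lp_norm s (restrict_space lborel {-1..1})
          (\<lambda>t. ennreal (norm (radon perp f t \<omega>))))
         \<le> ennreal B * Lp_norm p lborel (\<lambda>x. ennreal (norm (f x)))"
      unfolding n h_def[symmetric] using B n by (simp add: ennreal_mult)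
  qed
qed

end
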